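(* Let $G,F\in\mathcal M_3(\mathbb R)$ have nonnegative off-diagonal entries, let $m\in\mathbb R^3$ have positive entries with $m^TF=0$, and let $0<a<A$. With the notation of the context, assume: (1) $G$ and $F$ are both reducible, and $G+\alpha F$ is irreducible for every $\alpha>0$. (2) The Perron eigenvalue $\alpha\mapsto\lambda_P(\alpha)$ is bounded on $(0,+\infty)$ and admits a global maximum on $(0,+\infty)$, attained at some $\alpha^*$ with $a<\alpha^*<A$. (3) Each of the vectors $e_0=\lim_{\alpha\to0}e_\alpha$ and $e_\infty=\lim_{\alpha\to+\infty}e_\alpha$ has at least one zero coordinate. (4) The quantity $\left\langle \frac{de_\alpha}{d\alpha},\Theta Fe_\alpha\right\rangle$ has a constant strict sign for $\alpha\ge 0$ (it is positive for all $\alpha\geq 0$ or negative for all $\alpha\ge0$). (5) There exists $\delta_0>0$ such that: for any constant $\beta\in(A-\delta_0,A+\delta_0)$, the trajectory of $\dot y=b(y,\beta)$ starting from $e_0$ (which connects $e_0$ to $e_\beta$) does not cross $\Phi_0$ for $t>0$; and for any constant $\beta\in(a-\delta_0,a+\delta_0)$, the trajectory of $\dot y=b(y,\beta)$ starting from $e_\infty$ (which connects $e_\infty$ to $e_\beta$) does not cross $\Phi_0$ for $t>0$. For $\epsilon>0$ and $y\in\mathcal S$ let $$u_\epsilon(y)=\sup_\alpha\left\{\int_0^{+\infty}e^{-\epsilon t}L(y_\alpha(t))\,dt\;:\;\dot y_\alpha(t)=b(y_\alpha(t),\alpha(t)),\ y_\alpha(0)=y\right\},$$ where the supremum is over all measurable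 $\alpha:(0,+\infty)\to[a,A]$. Then there exists a constant $\lambda_{HJ}\in\mathbb R$ such that $$\lim_{\epsilon\to0}\epsilon u_\epsilon(y)=\lambda_{HJ}\quad\text{uniformly for }y\in\mathcal S.$$
   Context: Notation. $\mathcal S=\{y\in\mathbb R^3: y\ge0,\ \langle m,y\rangle=1\}$, with tangent space $T\mathcal S=\{v\in\mathbb R^3:\langle m,v\rangle=0\}$ equipped with the Euclidean inner product of $\mathbb R^3$; $\Theta$ is the direct rotation by angle $\pi/2$ on the plane $T\mathcal S$ (for a fixed orientation). $L(y)=\langle m,Gy\rangle$. The vector field on $\mathcal S$ with control parameter $\alpha$ is $b(y,\alpha)=(G+\alpha F)y-\langle m,Gy\rangle y$ (it is tangent to $\mathcal S$). For $\alpha>0$, since $G+\alpha F$ is irreducible with nonnegative off-diagonal entries, Perron–Frobenius gives a simple dominant real eigenvalue $\lambda_P(\alpha)$ and a unique positive eigenvector $e_\alpha$ with $(G+\alpha F)e_\alpha=\lambda_P(\alpha)e_\alpha$ and $\langle m,e_\alpha\rangle=1$. $e_0$ and $e_\infty$ denote the limits of $e_\alpha$ as $\alpha\to0$ and $\alpha\to+\infty$. $\Phi_0=\{e_\alpha:\alpha\in[0,+\infty)\}\subset\mathcal S$ is the set of Perron eigenvectors. At $\alpha=0$, $\frac{de_\alpha}{d\alpha}$ is the right derivative. *)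

theory Defs
  imports "HOL-Analysis.Analysis" "HOL-Analysis.Cross3"
begin

definition metzler :: "real^'n^'n \<Rightarrow> bool" where
  "metzler M \<longleftrightarrow> (\<forall>i j. i \<noteq> j \<longrightarrow> 0 \<le> M $ i $ j)"

definition reducible :: "real^'n^'n \<Rightarrow> bool" where
  "reducible M \<longleftrightarrow> (\<exists>I. I \<noteq> {} \<and> I \<noteq> UNIV \<and> (\<forall>i\<in>I. \<forall>j\<in>-I. M $ i $ j = 0))"

definition complex_eigenvalue :: "real^'n^'n \<Rightarrow> complex \<Rightarrow> bool" where
  "complex_eigenvalue M z \<longleftrightarrow>
     (\<exists>v::complex^'n. v \<noteq> 0 \<and> map_matrix complex_of_real M *v v = z *s v)"

text \<open>
  Dominance is meant in the sense of largest real part, as is usual for matrices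
  with nonnegative off-diagonal entries. This determines the value uniquely; its existence for
  irreducible such matrices is part of the Perron--Frobenius theorem.
\<close>

definition perron_value :: "real^'n^'n \<Rightarrow> real" where
  "perron_value M = (THE l. complex_eigenvalue M (complex_of_real l) \<and>
     (\<forall>z. complex_eigenvalue M z \<longrightarrow> Re z \<le> l))"

definition perron_vector :: "real^'n \<Rightarrow> real^'n^'n \<Rightarrow> real^'n" where
  "perron_vector m M =
     (THE e. (\<forall>i. 0 < e $ i) \<and> M *v e = perron_value M *\<^sub>R e \<and> m \<bullet> e = 1)"

definition simplex_of :: "real^'n \<Rightarrow> (real^'n) set" where
  "simplex_of m = {y. (\<forall>i. 0 \<le> y $ i) \<and> m \<bullet> y = 1}"

text \<open>
  The rotation by a quarter turn of the plane orthogonal to \<open>m\<close>, oriented by its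
  normal \<open>m\<close>. Only its values on that plane matter.
\<close>

definition quarter_turn :: "real^3 \<Rightarrow> real^3 \<Rightarrow> real^3" where
  "quarter_turn m v = cross3 (m /\<^sub>R norm m) v"

definition growth_rate :: "real^'n^'n \<Rightarrow> real^'n \<Rightarrow> real^'n \<Rightarrow> real" where
  "growth_rate G m y = m \<bullet> (G *v y)"

definition drift ::
  "real^'n^'n \<Rightarrow> real^'n^'n \<Rightarrow> real^'n \<Rightarrow> real^'n \<Rightarrow> real \<Rightarrow> real^'n" where
  "drift G F m y \<alpha> = (G + \<alpha> *\<^sub>R F) *v y - (m \<bullet> (G *v y)) *\<^sub>R y"

text \<open>
  Solutions on \<open>[0, \<infinity>)\<close> of the controlled equation for a time-dependent control \<open>\<alpha>\<close>, in the sense of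
  Caratheodory (integral form). For a constant control these are exactly the classical
  solutions. The vector field lives on the simplex, so the curve is required to stay there; for
  a control with nonnegative values and an initial point in the simplex this is automatic.
\<close>

definition trajectory ::
  "real^'n^'n \<Rightarrow> real^'n^'n \<Rightarrow> real^'n \<Rightarrow> (real \<Rightarrow> real) \<Rightarrow> (real \<Rightarrow> real^'n) \<Rightarrow> bool" where
  "trajectory G F m \<alpha> y \<longleftrightarrow>
     (\<forall>t\<ge>0. y t \<in> simplex_of m \<and>
        set_integrable lebesgue {0<..t} (\<lambda>s. drift G F m (y s) (\<alpha> s)) \<and>
        y t = y 0 + (LINT s:{0<..t}|lebesgue. drift G F m (y s) (\<alpha> s)))"

definition admissible_control :: "real \<Rightarrow> real \<Rightarrow> (real \<Rightarrow> real) \<Rightarrow> bool" where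
  "admissible_control a A \<alpha> \<longleftrightarrow>
     \<alpha> \<in> borel_measurable (lebesgue_on {0<..}) \<and> (\<forall>t>0. \<alpha> t \<in> {a..A})"

text \<open>
  For \<open>y0\<close> in the simplex the supremum is over a nonempty bounded set when \<open>0 < a \<le> A\<close>, \<open>\<epsilon> > 0\<close>,
  \<open>G\<close> and \<open>F\<close> have nonnegative off-diagonal entries, and \<open>m\<close> is positive with \<open>m v* F = 0\<close>.
\<close>

definition discounted_value ::
  "real^'n^'n \<Rightarrow> real^'n^'n \<Rightarrow> real^'n \<Rightarrow> real \<Rightarrow> real \<Rightarrow> real \<Rightarrow> real^'n \<Rightarrow> real" where
  "discounted_value G F m a A \<epsilon> y0 =
     Sup {LINT t:{0<..}|lebesgue. exp (- \<epsilon> * t) * growth_rate G m (y t) | \<alpha> y.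
            admissible_control a A \<alpha> \<and> trajectory G F m \<alpha> y \<and> y 0 = y0}"

end

(*
  A trajectory y lifts to z(t) = exp(c t + int_0^t L(y)) y(t), which solves the linear equation
  z' = (G + alpha F + c I) z; for large c all entries of the matrix are nonnegative. For controls
  in [a,A] its off-diagonal entries dominate those of the irreducible matrix G + a F. Hence after
  some fixed time all components of z are comparable, and since the linear flow is order
  preserving, two trajectories with the same control have accumulated growths int_0^t L that
  differ by at most a constant K, uniformly in t, the control and the starting points.

  Let S(T) be the supremum of int_0^T L over all trajectories. Cutting a trajectory into pieces of
  length T bounds its growth by S(T)/T per unit time, and repeating a nearly optimal control
  periodically achieves (S(T) - 1 - K)/T from any starting point. Integrating by parts in the
  discounted integral, epsilon u_epsilon(y) differs from S(T)/T by at most (1 + K)/T + O(epsilon),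
  uniformly in y, so epsilon u_epsilon is uniformly Cauchy as epsilon tends to 0.
*)

theory Submission
  imports Defs
begin

text \<open>Controls are merely measurable, so a solution need not be differentiable at a prescribed
  time. Calculus is therefore done with integrated increments, and the product rule is used only
  with one continuously differentiable factor. Such a factor exists because
  \<open>m v* F = 0\<close>: the growth rate does not contain the control, so it is continuous along
  a path. The quadratic equation on the simplex is never solved directly; its solutions arise as
  projections of solutions of the linear lift. The added multiple c I does more than make the
  entries nonnegative: every component of a nonnegative solution becomes nondecreasing. A lower
  bound obtained along a chain of indices thus survives waiting, and chains of different lengths can
  be compared at one common time. The constant K is lost once per period of length T, hence costs
  K/T on average. Errors that grow with T appear only with a factor epsilon, so epsilon tends to 0
  at fixed T, and T to infinity afterwards.\<close>

section \<open>Primitives of bounded integrands\<close>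

text \<open>Encodes a Lipschitz curve through an integrand that plays the role of its derivative,
  with no derivative required at any point. The bound on \<open>w\<close> holds at every time, so
  Lipschitz estimates follow directly. For T < 0 the condition is void, which lets later statements
  quantify over all T.\<close>

definition bounded_primitive ::
  "real \<Rightarrow> (real \<Rightarrow> 'a::euclidean_space) \<Rightarrow> (real \<Rightarrow> 'a) \<Rightarrow> bool" where
  "bounded_primitive T w x \<longleftrightarrow>
     (\<exists>B. \<forall>t\<in>{0..T}. norm (w t) \<le> B) \<and>
     (\<forall>t\<in>{0..T}. (w has_integral (x t - x 0)) {0..t})"

lemma bounded_primitiveI:
  assumes "\<And>t. t \<in> {0..T} \<Longrightarrow> norm (w t) \<le> B"
    and "\<And>t. t \<in> {0..T} \<Longrightarrow> (w has_integral (x t - x 0)) {0..t}"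
  shows "bounded_primitive T w x"
  using assms unfolding bounded_primitive_def by blast

lemma bounded_primitive_bound:
  assumes "bounded_primitive T w x"
  obtains B where "0 \<le> B" "\<And>t. t \<in> {0..T} \<Longrightarrow> norm (w t) \<le> B"
proof -
  obtain B where B: "\<forall>t\<in>{0..T}. norm (w t) \<le> B"
    using assms unfolding bounded_primitive_def by blast
  show ?thesis
    using that[of "\<bar>B\<bar>"] B abs_ge_self[of B] order_trans by fastforce
qed

lemma bounded_primitive_increment:
  assumes "bounded_primitive T w x" "0 \<le> s" "s \<le> t" "t \<le> T"
  shows "(w has_integral (x t - x s)) {s..t}"
proof -
  have t: "(w has_integral (x t - x 0)) {0..t}" and s: "(w has_integral (x s - x 0)) {0..s}"
    using assms unfolding bounded_primitive_def by auto
  have "w integrable_on {s..t}"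
    using t integrable_subinterval_real[of w 0 t s t] assms by auto
  then obtain j where j: "(w has_integral j) {s..t}" by blast
  have "(w has_integral (x s - x 0 + j)) {0..t}"
    using has_integral_combine[OF _ _ s j] assms by auto
  with t have "x t - x 0 = x s - x 0 + j" by (rule has_integral_unique)
  with j show ?thesis by (simp add: algebra_simps)
qed

lemma bounded_primitive_mono:
  "bounded_primitive T w x \<Longrightarrow> S \<le> T \<Longrightarrow> bounded_primitive S w x"
  unfolding bounded_primitive_def by (meson atLeastAtMost_iff order_trans)

lemma bounded_primitive_cong:
  assumes "bounded_primitive T w x"
    and "\<And>t. t \<in> {0..T} \<Longrightarrow> w t = w' t" "\<And>t. t \<in> {0..T} \<Longrightarrow> x t = x' t"
  shows "bounded_primitive T w' x'"
proof -
  obtain B where B: "\<And>t. t \<in> {0..T} \<Longrightarrow> norm (w t) \<le> B"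
    using bounded_primitive_bound[OF assms(1)] by metis
  show ?thesis
  proof (rule bounded_primitiveI)
    show "norm (w' t) \<le> B" if "t \<in> {0..T}" for t using B[OF that] assms(2)[OF that] by simp
    show "(w' has_integral (x' t - x' 0)) {0..t}" if "t \<in> {0..T}" for t
    proof (rule has_integral_eq)
      have "(w has_integral (x t - x 0)) {0..t}"
        using assms(1) that unfolding bounded_primitive_def by blast
      then show "(w has_integral (x' t - x' 0)) {0..t}"
        using assms(3)[of t] assms(3)[of 0] that by simp
    qed (use that assms(2) in auto)
  qed
qed

lemma bounded_primitive_lipschitz:
  assumes "bounded_primitive T w x"
  obtains B where "0 \<le> B" "\<And>t. t \<in> {0..T} \<Longrightarrow> norm (w t) \<le> B"
    "\<And>s t. s \<in> {0..T} \<Longrightarrow> t \<in> {0..T} \<Longrightarrow> norm (x t - x s) \<le> B * \<bar>t - s\<bar>"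
proof -
  obtain B where B: "0 \<le> B" "\<And>t. t \<in> {0..T} \<Longrightarrow> norm (w t) \<le> B"
    using bounded_primitive_bound[OF assms] by metis
  have *: "norm (x t - x s) \<le> B * (t - s)" if "0 \<le> s" "s \<le> t" "t \<le> T" for s t
  proof -
    have "norm (x t - x s) \<le> B * measure lborel (cbox s t)"
      by (rule has_integral_bound) (use bounded_primitive_increment[OF assms that] B that in auto)
    with that show ?thesis by simp
  qed
  show ?thesis
  proof (rule that[OF B])
    show "norm (x t - x s) \<le> B * \<bar>t - s\<bar>" if "s \<in> {0..T}" "t \<in> {0..T}" for s t
    proof (cases "s \<le> t")
      case True then show ?thesis using *[of s t] that by simp
    next
      case False then show ?thesis using *[of t s] that by (simp add: norm_minus_commute)
    qed
  qed
qed

lemma bounded_primitive_continuous: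
  assumes "bounded_primitive T w x"
  shows "continuous_on {0..T} x"
proof -
  obtain B where B: "0 \<le> B" "\<And>s t. s \<in> {0..T} \<Longrightarrow> t \<in> {0..T} \<Longrightarrow> norm (x t - x s) \<le> B * \<bar>t - s\<bar>"
    using bounded_primitive_lipschitz[OF assms] by metis
  have "B-lipschitz_on {0..T} x"
    by (rule lipschitz_onI) (use B in \<open>auto simp: dist_norm real_norm_def\<close>)
  then show ?thesis by (rule lipschitz_on_continuous_on)
qed

lemma bounded_primitive_of_deriv:
  assumes "continuous_on {0..T} w"
    and "\<And>t. t \<in> {0..T} \<Longrightarrow> (x has_vector_derivative w t) (at t within {0..T})"
  shows "bounded_primitive T w x"
proof -
  have "bounded (w ` {0..T})"
    using assms(1) by (intro compact_imp_bounded compact_continuous_image) auto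
  then obtain B where "\<And>t. t \<in> {0..T} \<Longrightarrow> norm (w t) \<le> B"
    unfolding bounded_iff by blast
  then show ?thesis
  proof (rule bounded_primitiveI)
    fix t assume "t \<in> {0..T}"
    then show "(w has_integral (x t - x 0)) {0..t}"
      by (intro fundamental_theorem_of_calculus)
        (auto intro!: has_vector_derivative_within_subset[OF assms(2)])
  qed
qed

text \<open>Where the integrand is continuous, pointwise derivatives are recovered. This serves to
  differentiate the reciprocal of the mass of a linear solution.\<close>

lemma bounded_primitive_deriv:
  assumes "bounded_primitive T w x" "continuous_on {0..T} w" "t \<in> {0..T}"
  shows "(x has_vector_derivative w t) (at t within {0..T})"
proof -
  have "((\<lambda>u. x 0 + integral {0..u} w) has_vector_derivative w t) (at t within {0..T})"
    using has_vector_derivative_add[OF has_vector_derivative_const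
        integral_has_vector_derivative[OF assms(2,3)]] by simp
  moreover have "x u = x 0 + integral {0..u} w" if "u \<in> {0..T}" for u
  proof -
    have "(w has_integral (x u - x 0)) {0..u}"
      using assms(1) that unfolding bounded_primitive_def by blast
    from integral_unique[OF this] show ?thesis by simp
  qed
  ultimately show ?thesis
    by (rule has_vector_derivative_transform[OF assms(3), rotated])
qed

lemma bounded_primitive_linear:
  assumes "bounded_linear f" "bounded_primitive T w x"
  shows "bounded_primitive T (\<lambda>t. f (w t)) (\<lambda>t. f (x t))"
proof -
  interpret f: bounded_linear f by fact
  obtain B where B: "0 \<le> B" "\<And>t. t \<in> {0..T} \<Longrightarrow> norm (w t) \<le> B"
    using bounded_primitive_bound[OF assms(2)] by metis
  obtain K where K: "0 \<le> K" "\<And>x. norm (f x) \<le> norm x * K"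
    using f.nonneg_bounded by blast
  show ?thesis
  proof (rule bounded_primitiveI)
    show "norm (f (w t)) \<le> B * K" if "t \<in> {0..T}" for t
      using K(2)[of "w t"] mult_right_mono[OF B(2)[OF that] K(1)] by linarith
    show "((\<lambda>t. f (w t)) has_integral f (x t) - f (x 0)) {0..t}" if "t \<in> {0..T}" for t
      using assms(2) that has_integral_linear[OF _ assms(1), of w "x t - x 0" "{0..t}"]
      unfolding bounded_primitive_def by (auto simp: o_def f.diff)
  qed
qed

lemma bounded_primitive_diff:
  assumes "bounded_primitive T w x" "bounded_primitive T w' x'"
  shows "bounded_primitive T (\<lambda>t. w t - w' t) (\<lambda>t. x t - x' t)"
proof -
  obtain B where B: "0 \<le> B" "\<And>t. t \<in> {0..T} \<Longrightarrow> norm (w t) \<le> B"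
    using bounded_primitive_bound[OF assms(1)] by metis
  obtain B' where B': "0 \<le> B'" "\<And>t. t \<in> {0..T} \<Longrightarrow> norm (w' t) \<le> B'"
    using bounded_primitive_bound[OF assms(2)] by metis
  show ?thesis
  proof (rule bounded_primitiveI)
    show "norm (w t - w' t) \<le> B + B'" if "t \<in> {0..T}" for t
      using B(2)[OF that] B'(2)[OF that] norm_triangle_ineq4[of "w t" "w' t"] by linarith
    show "((\<lambda>t. w t - w' t) has_integral x t - x' t - (x 0 - x' 0)) {0..t}"
      if "t \<in> {0..T}" for t
    proof -
      have "((\<lambda>t. w t - w' t) has_integral (x t - x 0) - (x' t - x' 0)) {0..t}"
        using assms that unfolding bounded_primitive_def by (intro has_integral_diff) auto
      then show ?thesis by (simp add: algebra_simps)
    qed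
  qed
qed

lemma bounded_primitive_shift:
  assumes "bounded_primitive (s + T) w x" "0 \<le> s"
  shows "bounded_primitive T (\<lambda>t. w (s + t)) (\<lambda>t. x (s + t))"
proof -
  obtain B where B: "0 \<le> B" "\<And>t. t \<in> {0..s+T} \<Longrightarrow> norm (w t) \<le> B"
    using bounded_primitive_bound[OF assms(1)] by metis
  show ?thesis
  proof (rule bounded_primitiveI)
    show "norm (w (s + t)) \<le> B" if "t \<in> {0..T}" for t using B that assms by auto
    show "((\<lambda>t. w (s + t)) has_integral x (s + t) - x (s + 0)) {0..t}" if "t \<in> {0..T}" for t
      using has_integral_shift_real_ivl[OF bounded_primitive_increment[OF assms(1), of s "s+t"], of s]
        that assms(2) by (simp add: add.commute)
  qed
qed

lemma integrable_scaleR_continuous: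
  fixes f :: "real \<Rightarrow> real" and g :: "real \<Rightarrow> 'a::euclidean_space"
  assumes "f integrable_on {s..t}" "\<And>r. r \<in> {s..t} \<Longrightarrow> \<bar>f r\<bar> \<le> B" "continuous_on {s..t} g"
  shows "(\<lambda>r. f r *\<^sub>R g r) integrable_on {s..t}"
proof -
  have f: "f absolutely_integrable_on {s..t}"
    by (rule absolutely_integrable_integrable_bound[of _ _ "\<lambda>_. B"]) (use assms in auto)
  have "(\<lambda>r. f r *\<^sub>R g r) absolutely_integrable_on {s..t}"
  proof (rule absolutely_integrable_bounded_measurable_product[where h = "\<lambda>u v. v *\<^sub>R u"])
    show "bilinear (\<lambda>(u::'a) (v::real). v *\<^sub>R u)"
      unfolding bilinear_def linear_iff by (simp add: algebra_simps)
    show "g \<in> borel_measurable (lebesgue_on {s..t})"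
      by (rule continuous_imp_measurable_on_sets_lebesgue) (use assms in auto)
    show "bounded (g ` {s..t})"
      using assms by (intro compact_imp_bounded compact_continuous_image) auto
  qed (use f in auto)
  then show ?thesis by (simp add: set_lebesgue_integral_eq_integral)
qed

text \<open>The two sides differ by a function with increments of second order, hence by a constant;
  this needs no pointwise derivative.\<close>

lemma bounded_primitive_scaleR:
  fixes f f' :: "real \<Rightarrow> real" and g g' :: "real \<Rightarrow> 'a::euclidean_space"
  assumes f: "bounded_primitive T f' f" "continuous_on {0..T} f'" and g: "bounded_primitive T g' g"
  shows "bounded_primitive T (\<lambda>t. f' t *\<^sub>R g t + f t *\<^sub>R g' t) (\<lambda>t. f t *\<^sub>R g t)"
proof (cases "0 \<le> T")
  case False then show ?thesis unfolding bounded_primitive_def by simp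
next
  case T: True
  obtain B where B: "0 \<le> B" "\<And>t. t \<in> {0..T} \<Longrightarrow> norm (f' t) \<le> B"
    "\<And>s t. s \<in> {0..T} \<Longrightarrow> t \<in> {0..T} \<Longrightarrow> norm (f t - f s) \<le> B * \<bar>t - s\<bar>"
    using bounded_primitive_lipschitz[OF f(1)] by metis
  obtain C where C: "0 \<le> C" "\<And>t. t \<in> {0..T} \<Longrightarrow> norm (g' t) \<le> C"
    "\<And>s t. s \<in> {0..T} \<Longrightarrow> t \<in> {0..T} \<Longrightarrow> norm (g t - g s) \<le> C * \<bar>t - s\<bar>"
    using bounded_primitive_lipschitz[OF g] by metis
  have fc: "continuous_on {0..T} f" and gc: "continuous_on {0..T} g"
    using f(1) g by (auto intro: bounded_primitive_continuous)
  define w where "w t = f' t *\<^sub>R g t + f t *\<^sub>R g' t" for t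
  have g'i: "g' integrable_on {0..T}"
    using g T unfolding bounded_primitive_def by auto
  have "(\<lambda>t. f t *\<^sub>R g' t) absolutely_integrable_on {0..T}"
  proof (rule absolutely_integrable_bounded_measurable_product[of "\<lambda>u v. u *\<^sub>R v"])
    show "bilinear (\<lambda>(u::real) (v::'a). u *\<^sub>R v)"
      unfolding bilinear_def linear_iff by (simp add: algebra_simps)
    show "f \<in> borel_measurable (lebesgue_on {0..T})"
      by (rule continuous_imp_measurable_on_sets_lebesgue) (use fc in auto)
    show "bounded (f ` {0..T})"
      using fc by (intro compact_imp_bounded compact_continuous_image) auto
    show "g' absolutely_integrable_on {0..T}"
      by (rule absolutely_integrable_integrable_bound[of _ _ "\<lambda>_. C"]) (use C g'i in auto)
  qed auto
  then have "(\<lambda>t. f t *\<^sub>R g' t) integrable_on {0..T}"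
    by (simp add: set_lebesgue_integral_eq_integral)
  moreover have "(\<lambda>t. f' t *\<^sub>R g t) integrable_on {0..T}"
    using f(2) gc by (intro integrable_continuous_real continuous_intros)
  ultimately have wi: "w integrable_on {0..T}"
    unfolding w_def by (rule integrable_add[rotated])
  then have wsub: "w integrable_on {s..t}" if "0 \<le> s" "t \<le> T" for s t
    using integrable_subinterval_real[of w 0 T s t] that by auto
  define \<phi> where "\<phi> t = f t *\<^sub>R g t - integral {0..t} w" for t
  \<comment> \<open>With g frozen at t and f frozen at s,
    \<open>(f t - f s) *\<^sub>R g t + f s *\<^sub>R (g t - g s)\<close> is exactly the increment of
    the product. Unfreezing at r changes the integrand by O(t - s), hence the integral by O((t -
    s)^2).\<close>
  have inc: "norm (\<phi> t - \<phi> s) \<le> (2 * B * C) * (t - s)^2" if "0 \<le> s" "s \<le> t" "t \<le> T" for s t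
  proof -
    have 1: "((\<lambda>r. f' r *\<^sub>R g t) has_integral (f t - f s) *\<^sub>R g t) {s..t}"
      by (intro has_integral_scaleR_left bounded_primitive_increment[OF f(1)] that)
    have 2: "((\<lambda>r. f s *\<^sub>R g' r) has_integral f s *\<^sub>R (g t - g s)) {s..t}"
      by (intro has_integral_cmul bounded_primitive_increment[OF g] that)
    have 3: "(w has_integral integral {s..t} w) {s..t}"
      using wsub that by auto
    have "integral {0..t} w = integral {0..s} w + integral {s..t} w"
      using Henstock_Kurzweil_Integration.integral_combine[of 0 s t w] wsub that by auto
    then have eq: "\<phi> t - \<phi> s = ((f t - f s) *\<^sub>R g t + f s *\<^sub>R (g t - g s)) - integral {s..t} w"
      unfolding \<phi>_def by (simp add: algebra_simps)
    have "norm (\<phi> t - \<phi> s) \<le> (2 * B * C * (t - s)) * measure lborel (cbox s t)"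
      unfolding eq
    proof (rule has_integral_bound)
      show "0 \<le> 2 * B * C * (t - s)" using B C that by simp
      show "((\<lambda>r. f' r *\<^sub>R g t + f s *\<^sub>R g' r - w r) has_integral
          (f t - f s) *\<^sub>R g t + f s *\<^sub>R (g t - g s) - integral {s..t} w) (cbox s t)"
        using has_integral_diff[OF has_integral_add[OF 1 2] 3] by simp
      fix r assume r: "r \<in> cbox s t"
      then have r': "r \<in> {0..T}" "s \<in> {0..T}" "t \<in> {0..T}" using that by auto
      have "f' r *\<^sub>R g t + f s *\<^sub>R g' r - w r = f' r *\<^sub>R (g t - g r) + (f s - f r) *\<^sub>R g' r"
        unfolding w_def by (simp add: algebra_simps)
      also have "norm \<dots> \<le> norm (f' r) * norm (g t - g r) + norm (f s - f r) * norm (g' r)"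
        by (metis norm_scaleR norm_triangle_ineq real_norm_def)
      also have "\<dots> \<le> B * (C * \<bar>t - r\<bar>) + (B * \<bar>s - r\<bar>) * C"
        using B C r' by (intro add_mono mult_mono) auto
      also have "\<dots> \<le> B * (C * (t - s)) + (B * (t - s)) * C"
        using r B C by (intro add_mono mult_mono) auto
      finally show "norm (f' r *\<^sub>R g t + f s *\<^sub>R g' r - w r) \<le> 2 * B * C * (t - s)"
        by (simp add: algebra_simps)
    qed
    then show ?thesis using that by (simp add: power2_eq_square)
  qed
  have inc': "norm (\<phi> t - \<phi> s) \<le> (2 * B * C) * (norm (t - s))^2" if "s \<in> {0..T}" "t \<in> {0..T}" for s t
    using inc[of s t] inc[of t s] that norm_minus_commute[of "\<phi> s" "\<phi> t"]
    by (cases "s \<le> t") (simp_all add: power2_commute[of t s])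
  \<comment> \<open>A quadratic bound on increments forces derivative zero at every point of the
    interval, so \<phi> is constant there.\<close>
  have "(\<phi> has_derivative (\<lambda>h. 0)) (at s within {0..T})" if s: "s \<in> {0..T}" for s
    unfolding has_derivative_within_alt
  proof (intro conjI allI impI)
    fix e :: real assume e: "0 < e"
    define d where "d = e / (2 * B * C + 1)"
    have pos: "0 < 2 * B * C + 1" using B(1) C(1) mult_nonneg_nonneg[OF B(1) C(1)] by linarith
    then have d: "0 < d" using e by (simp add: d_def)
    have "norm (\<phi> t - \<phi> s - 0) \<le> e * norm (t - s)" if "t \<in> {0..T}" "norm (t - s) < d" for t
    proof -
      have "(2 * B * C) * norm (t - s) \<le> (2 * B * C + 1) * d"
        using that B(1) C(1) d by (intro mult_mono) auto
      also have "\<dots> = e" using pos unfolding d_def by simp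
      finally have "(2 * B * C) * norm (t - s) * norm (t - s) \<le> e * norm (t - s)"
        by (rule mult_right_mono) simp
      then show ?thesis using inc'[OF s that(1)] by (simp add: power2_eq_square mult.assoc)
    qed
    with d show "\<exists>d>0. \<forall>y\<in>{0..T}. norm (y - s) < d \<longrightarrow> norm (\<phi> y - \<phi> s - 0) \<le> e * norm (y - s)"
      by blast
  qed (rule bounded_linear_zero)
  then obtain c where c: "\<And>t. t \<in> {0..T} \<Longrightarrow> \<phi> t = c"
    using has_derivative_zero_constant[of "{0..T}" \<phi>] by auto
  obtain K where K: "\<And>t. t \<in> {0..T} \<Longrightarrow> norm (f t) \<le> K"
    using compact_imp_bounded[OF compact_continuous_image[OF fc]] unfolding bounded_iff by blast
  obtain J where J: "\<And>t. t \<in> {0..T} \<Longrightarrow> norm (g t) \<le> J"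
    using compact_imp_bounded[OF compact_continuous_image[OF gc]] unfolding bounded_iff by blast
  show ?thesis
  proof (rule bounded_primitiveI)
    fix t assume t: "t \<in> {0..T}"
    have "norm (f' t *\<^sub>R g t + f t *\<^sub>R g' t) \<le> norm (f' t) * norm (g t) + norm (f t) * norm (g' t)"
      by (metis norm_scaleR norm_triangle_ineq real_norm_def)
    also have "\<dots> \<le> B * J + K * C"
      using B(2)[OF t] C(2)[OF t] K[OF t] J[OF t] B(1)
      by (intro add_mono mult_mono) (auto intro: order_trans[OF norm_ge_zero])
    finally show "norm (f' t *\<^sub>R g t + f t *\<^sub>R g' t) \<le> B * J + K * C" .
    have "integral {0..t} w = f t *\<^sub>R g t - f 0 *\<^sub>R g 0"
      using c[OF t] c[of 0] T unfolding \<phi>_def by (simp add: algebra_simps)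
    then show "((\<lambda>t. f' t *\<^sub>R g t + f t *\<^sub>R g' t) has_integral f t *\<^sub>R g t - f 0 *\<^sub>R g 0) {0..t}"
      using wsub[of 0 t] t unfolding w_def by (auto simp: has_integral_integrable_integral)
  qed
qed

text \<open>For the primitive N of n the inequality reads N' \<le> C N, so exp (- C t) N t is
  nonincreasing and starts at 0. Hence N vanishes, and the inequality then forces n to vanish
  too.\<close>

lemma gronwall_zero:
  fixes n :: "real \<Rightarrow> real"
  assumes "continuous_on {0..T} n" "\<And>t. t \<in> {0..T} \<Longrightarrow> 0 \<le> n t"
    and le: "\<And>t. t \<in> {0..T} \<Longrightarrow> n t \<le> C * integral {0..t} n" and t: "t \<in> {0..T}"
  shows "n t = 0"
proof -
  define N where "N t = integral {0..t} n" for t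
  have N': "(N has_vector_derivative n t) (at t within {0..T})" if "t \<in> {0..T}" for t
    unfolding N_def using integral_has_vector_derivative[OF assms(1) that] .
  have int: "((\<lambda>s. exp (- C * s) * (n s - C * N s)) has_integral
      exp (- C * t) * N t - exp (- C * 0) * N 0) {0..t}"
  proof (rule fundamental_theorem_of_calculus)
    fix s assume s: "s \<in> {0..t}"
    have "(N has_real_derivative n s) (at s within {0..t})"
      unfolding has_real_derivative_iff_has_vector_derivative
      by (rule has_vector_derivative_within_subset[OF N']) (use s t in auto)
    then show "((\<lambda>s. exp (- C * s) * N s) has_vector_derivative exp (- C * s) * (n s - C * N s))
        (at s within {0..t})"
      unfolding has_real_derivative_iff_has_vector_derivative[symmetric]
      by (auto intro!: derivative_eq_intros simp: algebra_simps)
  qed (use t in auto)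
  have "exp (- C * t) * N t - exp (- C * 0) * N 0 \<le> 0"
  proof (rule has_integral_le[OF int has_integral_0])
    show "exp (- C * s) * (n s - C * N s) \<le> 0" if "s \<in> {0..t}" for s
      using le[of s] that t unfolding N_def by (auto intro!: mult_nonneg_nonpos)
  qed
  then have "N t \<le> 0" by (simp add: N_def mult_le_0_iff)
  moreover have "0 \<le> N t"
    unfolding N_def using assms(1,2) t
    by (intro integral_nonneg integrable_continuous_real) (auto intro: continuous_on_subset)
  ultimately have "N t = 0" by simp
  then show ?thesis using le[OF t] assms(2)[OF t] unfolding N_def by simp
qed

section \<open>The linear lift and the sign of its solutions\<close>

locale controlled_metzler =
  fixes G F :: "real^'n^'n" and m :: "real^'n" and a A :: real
  assumes metzler_G: "metzler G" and metzler_F: "metzler F"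
    and m_pos: "\<And>i. 0 < m $ i" and m_F: "m v* F = 0"
    and a_pos: "0 < a" and a_le_A: "a \<le> A"
    and irreducible: "\<not> reducible (G + a *\<^sub>R F)"
begin

text \<open>A normal form for admissible controls: measurable and [a, A]-valued on the whole line,
  so that shifting and periodic repetition stay within the class without side conditions at
  0.\<close>

definition control :: "(real \<Rightarrow> real) \<Rightarrow> bool" where
  "control \<alpha> \<longleftrightarrow> \<alpha> \<in> borel_measurable lebesgue \<and> (\<forall>t. \<alpha> t \<in> {a..A})"

text \<open>A crude constant dominating every entry of \<open>G + x *\<^sub>R F\<close> in absolute
  value, for all x in [a, A] at once. Adding it to the diagonal puts all entries of
  \<open>gen x\<close> between 0 and \<open>2 * shift_const\<close>.\<close>

definition shift_const :: real where
  "shift_const = (\<Sum>i\<in>UNIV. \<Sum>j\<in>UNIV. \<bar>G $ i $ j\<bar> + A * \<bar>F $ i $ j\<bar>)"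

definition gen :: "real \<Rightarrow> real^'n^'n" where
  "gen x = G + x *\<^sub>R F + mat shift_const"

definition linear_solution :: "real \<Rightarrow> (real \<Rightarrow> real) \<Rightarrow> (real \<Rightarrow> real^'n) \<Rightarrow> bool" where
  "linear_solution T \<alpha> z \<longleftrightarrow> bounded_primitive T (\<lambda>t. gen (\<alpha> t) *v z t) z"

lemma A_pos: "0 < A"
  using a_pos a_le_A by simp

lemma controlD: "control \<alpha> \<Longrightarrow> \<alpha> t \<in> {a..A}"
  by (simp add: control_def)

lemma entry_le_shift_const: "\<bar>G $ i $ j\<bar> + A * \<bar>F $ i $ j\<bar> \<le> shift_const"
proof -
  have "\<bar>G $ i $ j\<bar> + A * \<bar>F $ i $ j\<bar> \<le> (\<Sum>j\<in>UNIV. \<bar>G $ i $ j\<bar> + A * \<bar>F $ i $ j\<bar>)"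
    by (rule member_le_sum) (use A_pos in auto)
  also have "\<dots> \<le> shift_const"
    unfolding shift_const_def
    by (rule member_le_sum[of i UNIV "\<lambda>i. \<Sum>j\<in>UNIV. \<bar>G $ i $ j\<bar> + A * \<bar>F $ i $ j\<bar>"])
      (use A_pos in \<open>auto intro!: sum_nonneg\<close>)
  finally show ?thesis .
qed

lemma shift_const_nonneg: "0 \<le> shift_const"
  unfolding shift_const_def using A_pos by (intro sum_nonneg) auto

lemma gen_mult: "gen x *v z = G *v z + x *\<^sub>R (F *v z) + shift_const *\<^sub>R z"
proof -
  have "mat shift_const *v z = shift_const *\<^sub>R z"
    by (simp add: vec_eq_iff matrix_vector_mult_def mat_def if_distrib[of "\<lambda>u. u * _"] cong: if_cong)
  then show ?thesis
    by (simp add: gen_def matrix_vector_mult_add_rdistrib scaleR_matrix_vector_assoc)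
qed

lemma entry_bound:
  assumes "x \<in> {a..A}"
  shows "\<bar>G $ i $ j + x * F $ i $ j\<bar> \<le> shift_const"
proof -
  have "\<bar>G $ i $ j + x * F $ i $ j\<bar> \<le> \<bar>G $ i $ j\<bar> + x * \<bar>F $ i $ j\<bar>"
    using abs_triangle_ineq[of "G $ i $ j" "x * F $ i $ j"] assms a_pos by (simp add: abs_mult)
  also have "\<dots> \<le> \<bar>G $ i $ j\<bar> + A * \<bar>F $ i $ j\<bar>"
    using assms by (intro add_left_mono mult_right_mono) auto
  finally show ?thesis using entry_le_shift_const[of i j] by linarith
qed

lemma gen_nonneg:
  assumes "x \<in> {a..A}"
  shows "0 \<le> gen x $ i $ j"
proof (cases "i = j")
  case True
  then show ?thesis using entry_bound[OF assms, of i i] by (simp add: gen_def mat_def)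
next
  case False
  then show ?thesis
    using metzler_G metzler_F assms a_pos by (auto simp: gen_def mat_def metzler_def)
qed

lemma gen_le:
  assumes "x \<in> {a..A}"
  shows "gen x $ i $ j \<le> 2 * shift_const"
  using entry_bound[OF assms, of i j] shift_const_nonneg by (auto simp: gen_def mat_def)

text \<open>Off the diagonal F is nonnegative, so lowering x to a can only decrease the entry. The
  resulting lower bound is independent of the control, which lets one irreducible matrix govern all
  controls.\<close>

lemma gen_ge_offdiagonal:
  assumes "x \<in> {a..A}" "i \<noteq> j"
  shows "(G + a *\<^sub>R F) $ i $ j \<le> gen x $ i $ j"
  using assms metzler_F by (auto simp: gen_def mat_def metzler_def intro!: mult_right_mono)

lemma gen_norm_bound:
  obtains K where "0 \<le> K" "\<And>x z. x \<in> {a..A} \<Longrightarrow> norm (gen x *v z) \<le> K * norm z"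
proof -
  obtain KG where KG: "0 \<le> KG" "\<And>z. norm (G *v z) \<le> norm z * KG"
    using bounded_linear.nonneg_bounded[OF matrix_vector_mul_bounded_linear[of G]] by blast
  obtain KF where KF: "0 \<le> KF" "\<And>z. norm (F *v z) \<le> norm z * KF"
    using bounded_linear.nonneg_bounded[OF matrix_vector_mul_bounded_linear[of F]] by blast
  show ?thesis
  proof (rule that[of "KG + A * KF + shift_const"])
    show "0 \<le> KG + A * KF + shift_const" using KG KF A_pos shift_const_nonneg by simp
    fix x z assume x: "x \<in> {a..A}"
    have "norm (gen x *v z) \<le> norm (G *v z) + norm (x *\<^sub>R (F *v z)) + norm (shift_const *\<^sub>R z)"
      unfolding gen_mult by (meson add_right_mono norm_triangle_ineq order_trans)
    also have "\<dots> \<le> norm z * KG + A * (norm z * KF) + shift_const * norm z"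
    proof (intro add_mono)
      show "norm (x *\<^sub>R (F *v z)) \<le> A * (norm z * KF)"
        using x a_pos KF A_pos by (auto intro!: mult_mono)
    qed (use KG shift_const_nonneg in auto)
    finally show "norm (gen x *v z) \<le> (KG + A * KF + shift_const) * norm z"
      by (simp add: algebra_simps)
  qed
qed

lemma control_integrable:
  assumes "control \<alpha>"
  shows "\<alpha> integrable_on {s..t}"
proof -
  have "\<alpha> absolutely_integrable_on {s..t}"
  proof (rule measurable_bounded_by_integrable_imp_absolutely_integrable[of _ _ "\<lambda>_. A"])
    show "\<alpha> \<in> borel_measurable (lebesgue_on {s..t})"
      using assms measurable_restrict_space1 unfolding control_def by blast
    show "norm (\<alpha> r) \<le> A" if "r \<in> {s..t}" for r
      using controlD[OF assms, of r] a_pos by auto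
  qed auto
  then show ?thesis by (simp add: set_lebesgue_integral_eq_integral)
qed

lemma gen_integrable:
  assumes "control \<alpha>" "continuous_on {s..t} z"
  shows "(\<lambda>r. gen (\<alpha> r) *v z r) integrable_on {s..t}"
  unfolding gen_mult
proof (intro integrable_add)
  have lin: "continuous_on {s..t} (\<lambda>r. H *v z r)" for H :: "real^'n^'n"
    by (rule bounded_linear.continuous_on[OF matrix_vector_mul_bounded_linear assms(2)])
  show "(\<lambda>r. G *v z r) integrable_on {s..t}"
    by (intro integrable_continuous_real lin)
  show "(\<lambda>r. shift_const *\<^sub>R z r) integrable_on {s..t}"
    by (intro integrable_continuous_real continuous_intros assms)
  show "(\<lambda>r. \<alpha> r *\<^sub>R (F *v z r)) integrable_on {s..t}"
  proof (rule integrable_scaleR_continuous[OF control_integrable[OF assms(1)] _ lin])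
    show "\<bar>\<alpha> r\<bar> \<le> A" for r using controlD[OF assms(1), of r] a_pos by auto
  qed
qed

text \<open>Picard iteration written as a series: \<open>d k\<close> is the k-fold iterated integral
  applied to \<open>z0\<close>, and its norm is at most norm z0 (K t)^k / k!. Since the control is
  only measurable, the limit is taken under the integral by dominated convergence.\<close>

lemma linear_solution_exists:
  assumes \<alpha>: "control \<alpha>"
  obtains z where "z 0 = z0" "\<And>T. linear_solution T \<alpha> z"
proof -
  obtain K where K: "0 \<le> K" "\<And>x z. x \<in> {a..A} \<Longrightarrow> norm (gen x *v z) \<le> K * norm z"
    using gen_norm_bound by blast
  define d where "d = rec_nat (\<lambda>_. z0) (\<lambda>k f t. integral {0..t} (\<lambda>s. gen (\<alpha> s) *v f s))"
  have d0: "d 0 t = z0" for t by (simp add: d_def)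
  have dSuc: "d (Suc k) t = integral {0..t} (\<lambda>s. gen (\<alpha> s) *v d k s)" for k t
    by (simp add: d_def)
  have dc: "continuous_on {0..t} (d k)" for k t
  proof (induction k)
    case 0 then show ?case by (simp add: d_def)
  next
    case (Suc k)
    show ?case
      using indefinite_integral_continuous_1[OF gen_integrable[OF \<alpha> Suc]] by (simp add: dSuc[abs_def])
  qed
  \<comment> \<open>These majorants reproduce themselves: \<open>K * b k\<close> is the derivative
    of \<open>b (Suc k)\<close>. Their sum \<open>norm z0 * exp (K * t)\<close> bounds all partial
    sums and the limit.\<close>
  define b where "b k t = norm z0 * ((K * t) ^ k / fact k)" for k and t :: real
  have b': "((\<lambda>s. K * b k s) has_integral b (Suc k) t) {0..t}" if "0 \<le> t" for k t
  proof -
    have "((\<lambda>s. K * b k s) has_integral b (Suc k) t - b (Suc k) 0) {0..t}"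
    proof (rule fundamental_theorem_of_calculus[OF that])
      fix s
      have "((\<lambda>s. (K * s) ^ Suc k) has_real_derivative (1 + real k) * (K * (K * s) ^ k))
          (at s within {0..t})"
        by (rule DERIV_power_Suc) (auto intro!: derivative_eq_intros)
      then have "(b (Suc k) has_real_derivative
          norm z0 * ((1 + real k) * (K * (K * s) ^ k) / fact (Suc k))) (at s within {0..t})"
        unfolding b_def[abs_def] by (intro DERIV_cmult DERIV_cdivide)
      also have "norm z0 * ((1 + real k) * (K * (K * s) ^ k) / fact (Suc k)) = K * b k s"
        using of_nat_neq_0[where 'a = real, of k] by (simp add: b_def divide_simps)
      finally show "(b (Suc k) has_vector_derivative K * b k s) (at s within {0..t})"
        by (simp add: has_real_derivative_iff_has_vector_derivative)
    qed
    then show ?thesis by (simp add: b_def)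
  qed
  have db: "norm (d k t) \<le> b k t" if "0 \<le> t" for k t
    using that
  proof (induction k arbitrary: t)
    case 0 then show ?case by (simp add: d0 b_def)
  next
    case (Suc k)
    have "norm (d (Suc k) t) \<le> integral {0..t} (\<lambda>s. K * b k s)"
      unfolding dSuc
    proof (rule integral_norm_bound_integral)
      fix s assume "s \<in> {0..t}"
      then show "norm (gen (\<alpha> s) *v d k s) \<le> K * b k s"
        using K(2)[OF controlD[OF \<alpha>], of s "d k s"] mult_left_mono[OF Suc.IH K(1), of s] by simp
    qed (use gen_integrable[OF \<alpha> dc] b'[OF Suc.prems] in auto)
    then show ?case using integral_unique[OF b'[OF Suc.prems]] by simp
  qed
  have bsum: "(\<lambda>k. b k t) sums (norm z0 * exp (K * t))" for t
    unfolding b_def using sums_mult[OF exp_converges[of "K * t"], of "norm z0"]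
    by (simp add: divide_inverse mult_ac)
  have bpos: "0 \<le> b k t" if "0 \<le> t" for k t using K(1) that by (simp add: b_def)
  have dsum: "summable (\<lambda>k. d k t)" if "0 \<le> t" for t
    by (rule summable_comparison_test'[OF sums_summable[OF bsum]]) (use db that in auto)
  define S where "S n t = (\<Sum>k<n. d k t)" for n t
  define z where "z t = (\<Sum>k. d k t)" for t
  have Slim: "(\<lambda>n. S n t) \<longlonglongrightarrow> z t" if "0 \<le> t" for t
    unfolding S_def z_def by (rule summable_LIMSEQ[OF dsum[OF that]])
  have Sb: "norm (S n t) \<le> norm z0 * exp (K * t)" if "0 \<le> t" for n t
  proof -
    have "norm (S n t) \<le> (\<Sum>k<n. b k t)"
      unfolding S_def by (rule sum_norm_le) (use db that in auto)
    also have "\<dots> \<le> (\<Sum>k. b k t)"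
      by (rule sum_le_suminf[OF sums_summable[OF bsum]]) (use bpos that in auto)
    finally show ?thesis using sums_unique[OF bsum] by simp
  qed
  have zb: "norm (z t) \<le> norm z0 * exp (K * t)" if "0 \<le> t" for t
    using Lim_bounded[OF tendsto_norm[OF Slim[OF that]], of 0] Sb[OF that] by auto
  have genS: "gen x *v S n s = (\<Sum>k<n. gen x *v d k s)" for x n s
    unfolding S_def by (rule linear_sum[OF matrix_vector_mul_linear])
  have SSuc: "S (Suc n) t = z0 + integral {0..t} (\<lambda>s. gen (\<alpha> s) *v S n s)" for n t
  proof -
    have "S (Suc n) t = z0 + (\<Sum>k<n. d (Suc k) t)"
      unfolding S_def by (simp only: sum.lessThan_Suc_shift d0)
    also have "(\<Sum>k<n. d (Suc k) t) = integral {0..t} (\<lambda>s. gen (\<alpha> s) *v S n s)"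
      unfolding genS dSuc by (rule integral_sum[symmetric]) (auto intro: gen_integrable[OF \<alpha> dc])
    finally show ?thesis .
  qed
  have Sint: "(\<lambda>s. gen (\<alpha> s) *v S n s) integrable_on {0..t}" for n t
    unfolding genS by (rule integrable_sum) (auto intro: gen_integrable[OF \<alpha> dc])
  have zint: "((\<lambda>s. gen (\<alpha> s) *v z s) has_integral (z t - z0)) {0..t}" if t: "0 \<le> t" for t
  proof -
    have bound: "norm (gen (\<alpha> s) *v S n s) \<le> K * (norm z0 * exp (K * t))" if "s \<in> {0..t}" for s n
    proof -
      have "norm (gen (\<alpha> s) *v S n s) \<le> K * norm (S n s)" by (rule K(2)[OF controlD[OF \<alpha>]])
      also have "\<dots> \<le> K * (norm z0 * exp (K * s))"
        using that by (intro mult_left_mono Sb K) auto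
      also have "\<dots> \<le> K * (norm z0 * exp (K * t))"
        using that K(1) by (intro mult_left_mono) (auto intro: mult_left_mono)
      finally show ?thesis .
    qed
    have lim: "(\<lambda>n. gen (\<alpha> s) *v S n s) \<longlonglongrightarrow> gen (\<alpha> s) *v z s" if "s \<in> {0..t}" for s
      using that by (intro bounded_linear.tendsto[OF matrix_vector_mul_bounded_linear] Slim) auto
    have i: "(\<lambda>s. gen (\<alpha> s) *v z s) integrable_on {0..t}"
      by (rule dominated_convergence(1)[OF Sint integrable_const_ivl bound lim])
    have l: "(\<lambda>n. integral {0..t} (\<lambda>s. gen (\<alpha> s) *v S n s)) \<longlonglongrightarrow>
        integral {0..t} (\<lambda>s. gen (\<alpha> s) *v z s)"
      by (rule dominated_convergence(2)[OF Sint integrable_const_ivl bound lim])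
    have "(\<lambda>n. S (Suc n) t) \<longlonglongrightarrow> z0 + integral {0..t} (\<lambda>s. gen (\<alpha> s) *v z s)"
      unfolding SSuc by (intro tendsto_intros l)
    moreover have "(\<lambda>n. S (Suc n) t) \<longlonglongrightarrow> z t"
      by (rule LIMSEQ_Suc[OF Slim[OF t]])
    ultimately have "z t = z0 + integral {0..t} (\<lambda>s. gen (\<alpha> s) *v z s)"
      using LIMSEQ_unique by blast
    then have "integral {0..t} (\<lambda>s. gen (\<alpha> s) *v z s) = z t - z0" by simp
    with integrable_integral[OF i] show ?thesis by simp
  qed
  have z0: "z 0 = z0"
    using has_integral_unique[OF zint[of 0] has_integral_null_real] by simp
  have "linear_solution T \<alpha> z" for T
    unfolding linear_solution_def
  proof (rule bounded_primitiveI)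
    show "norm (gen (\<alpha> t) *v z t) \<le> K * (norm z0 * exp (K * T))" if "t \<in> {0..T}" for t
    proof -
      have "norm (gen (\<alpha> t) *v z t) \<le> K * norm (z t)" by (rule K(2)[OF controlD[OF \<alpha>]])
      also have "\<dots> \<le> K * (norm z0 * exp (K * t))"
        using that by (intro mult_left_mono zb K) auto
      also have "\<dots> \<le> K * (norm z0 * exp (K * T))"
        using that K(1) by (intro mult_left_mono) (auto intro: mult_left_mono)
      finally show ?thesis .
    qed
  qed (use zint z0 in auto)
  with z0 show ?thesis by (rule that)
qed

lemma linear_solution_component:
  assumes "linear_solution T \<alpha> z"
  shows "bounded_primitive T (\<lambda>t. \<Sum>j\<in>UNIV. gen (\<alpha> t) $ i $ j * z t $ j) (\<lambda>t. z t $ i)"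
  using bounded_primitive_linear[OF bounded_linear_vec_nth assms[unfolded linear_solution_def], of i]
  by (simp add: matrix_vector_mult_def)

text \<open>Gronwall applied to the total negative part. Because the matrix entries lie in [0, 2c],
  where c is \<open>shift_const\<close>, only negative components can push a component down, at a
  rate of at most 2c times that total. By linearity this also gives order preservation, when applied
  to a difference of two solutions.\<close>

lemma linear_solution_nonneg:
  assumes \<alpha>: "control \<alpha>" and z: "linear_solution T \<alpha> z" and z0: "\<And>i. 0 \<le> z 0 $ i"
    and t: "t \<in> {0..T}"
  shows "0 \<le> z t $ i"
proof -
  define n where "n t = (\<Sum>i\<in>UNIV. max 0 (- (z t $ i)))" for t
  note comp = linear_solution_component[OF z]
  have nc: "continuous_on {0..T} n"
    unfolding n_def
    by (intro continuous_on_sum continuous_on_max continuous_on_const continuous_on_minus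
        bounded_primitive_continuous[OF comp])
  have n0: "0 \<le> n t" for t unfolding n_def by (rule sum_nonneg) simp
  have one: "max 0 (- (z t $ i)) \<le> 2 * shift_const * integral {0..t} n" if t: "t \<in> {0..T}" for t i
  proof -
    have ni: "n integrable_on {0..t}"
      by (rule integrable_continuous_real[OF continuous_on_subset[OF nc]]) (use t in auto)
    have "- (2 * shift_const) * integral {0..t} n \<le> z t $ i - z 0 $ i"
    proof (rule has_integral_le)
      show "((\<lambda>s. - (2 * shift_const) * n s) has_integral - (2 * shift_const) * integral {0..t} n) {0..t}"
        by (intro has_integral_mult_right integrable_integral ni)
      show "((\<lambda>s. \<Sum>j\<in>UNIV. gen (\<alpha> s) $ i $ j * z s $ j) has_integral z t $ i - z 0 $ i) {0..t}"
        by (rule bounded_primitive_increment[OF comp]) (use t in auto)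
      fix s
      have "- (2 * shift_const) * n s = (\<Sum>j\<in>UNIV. - (2 * shift_const * max 0 (- (z s $ j))))"
        unfolding n_def by (simp add: sum_distrib_left sum_negf)
      also have "\<dots> \<le> (\<Sum>j\<in>UNIV. gen (\<alpha> s) $ i $ j * z s $ j)"
      proof (rule sum_mono)
        fix j
        have "gen (\<alpha> s) $ i $ j * (- (z s $ j)) \<le> gen (\<alpha> s) $ i $ j * max 0 (- (z s $ j))"
          by (intro mult_left_mono gen_nonneg controlD[OF \<alpha>]) simp
        also have "\<dots> \<le> 2 * shift_const * max 0 (- (z s $ j))"
          by (intro mult_right_mono gen_le controlD[OF \<alpha>]) simp
        finally show "- (2 * shift_const * max 0 (- (z s $ j))) \<le> gen (\<alpha> s) $ i $ j * z s $ j"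
          by simp
      qed
      finally show "- (2 * shift_const) * n s \<le> (\<Sum>j\<in>UNIV. gen (\<alpha> s) $ i $ j * z s $ j)" .
    qed
    \<comment> \<open>This covers the branch of the maximum where the negative part is 0; the
      preceding estimate covers the other.\<close>
    moreover have "0 \<le> 2 * shift_const * integral {0..t} n"
      using shift_const_nonneg integral_nonneg[OF ni n0] by simp
    ultimately show ?thesis using z0[of i] by simp
  qed
  have "n t = 0"
  proof (rule gronwall_zero[OF nc n0 _ t])
    fix t assume t: "t \<in> {0..T}"
    have "n t \<le> (\<Sum>i\<in>(UNIV::'n set). 2 * shift_const * integral {0..t} n)"
      unfolding n_def[of t] by (rule sum_mono[OF one[OF t]])
    then show "n t \<le> (real CARD('n) * (2 * shift_const)) * integral {0..t} n" by simp
  qed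
  then have "max 0 (- (z t $ i)) = 0"
    unfolding n_def by (subst (asm) sum_nonneg_eq_0_iff) auto
  then show ?thesis by simp
qed

section \<open>Uniform positivity from irreducibility\<close>

definition nonneg_solution :: "real \<Rightarrow> (real \<Rightarrow> real) \<Rightarrow> (real \<Rightarrow> real^'n) \<Rightarrow> bool" where
  "nonneg_solution T \<alpha> z \<longleftrightarrow>
     control \<alpha> \<and> linear_solution T \<alpha> z \<and> (\<forall>t\<in>{0..T}. \<forall>i. 0 \<le> z t $ i)"

text \<open>All matrix entries and all components are nonnegative, so the integrand of each
  component is too. This monotonicity is the benefit of the diagonal shift: a lower bound, once
  reached, persists.\<close>

lemma nonneg_solution_mono:
  assumes "nonneg_solution T \<alpha> z" "0 \<le> s" "s \<le> t" "t \<le> T"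
  shows "z s $ i \<le> z t $ i"
proof -
  have z: "control \<alpha>" "linear_solution T \<alpha> z" "\<forall>t\<in>{0..T}. \<forall>i. 0 \<le> z t $ i"
    using assms(1) unfolding nonneg_solution_def by auto
  have "0 \<le> z t $ i - z s $ i"
    by (rule has_integral_nonneg[OF bounded_primitive_increment[OF linear_solution_component[OF z(2)]]])
      (use assms z in \<open>auto intro!: sum_nonneg mult_nonneg_nonneg gen_nonneg controlD[OF z(1)]\<close>)
  then show ?thesis by simp
qed

text \<open>During one unit of time component j stays at least at its initial value, so the single
  term (i, j) of the matrix product already contributes the claimed amount to component i.\<close>

lemma nonneg_solution_step:
  assumes "nonneg_solution T \<alpha> z" "0 \<le> s" "s + 1 \<le> T" "i \<noteq> j" "0 \<le> (G + a *\<^sub>R F) $ i $ j"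
  shows "(G + a *\<^sub>R F) $ i $ j * z s $ j \<le> z (s + 1) $ i"
proof -
  let ?p = "(G + a *\<^sub>R F) $ i $ j"
  have z: "control \<alpha>" "linear_solution T \<alpha> z" "\<And>t i. t\<in>{0..T} \<Longrightarrow> 0 \<le> z t $ i"
    using assms(1) unfolding nonneg_solution_def by auto
  have "((\<lambda>t. ?p * z s $ j) has_integral ?p * z s $ j) {s..s+1}"
    using has_integral_const_real[of "?p * z s $ j" s "s+1"] by simp
  then have "?p * z s $ j \<le> z (s + 1) $ i - z s $ i"
  proof (rule has_integral_le)
    show "((\<lambda>t. \<Sum>j\<in>UNIV. gen (\<alpha> t) $ i $ j * z t $ j) has_integral z (s+1) $ i - z s $ i) {s..s+1}"
      by (rule bounded_primitive_increment[OF linear_solution_component[OF z(2)]]) (use assms in auto)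
    fix t assume t: "t \<in> {s..s+1}"
    then have tT: "t \<in> {0..T}" using assms by auto
    have "?p * z s $ j \<le> gen (\<alpha> t) $ i $ j * z t $ j"
      by (intro mult_mono gen_ge_offdiagonal controlD z assms(4) gen_nonneg
          nonneg_solution_mono[OF assms(1)]) (use t assms in auto)
    also have "\<dots> \<le> (\<Sum>j\<in>UNIV. gen (\<alpha> t) $ i $ j * z t $ j)"
      by (rule member_le_sum[of j UNIV "\<lambda>j. gen (\<alpha> t) $ i $ j * z t $ j"])
        (use z tT in \<open>auto intro!: mult_nonneg_nonneg gen_nonneg controlD[OF z(1)]\<close>)
    finally show "?p * z s $ j \<le> (\<Sum>j\<in>UNIV. gen (\<alpha> t) $ i $ j * z t $ j)" .
  qed
  moreover have "0 \<le> z s $ i" using z(3)[of s i] assms by simp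
  ultimately show ?thesis by simp
qed

text \<open>A quantitative form of reachability from j to i in the graph of the matrix: the delay N
  and the factor \<delta> are chosen before the control, the solution and the starting time.\<close>

definition feeds :: "'n \<Rightarrow> 'n \<Rightarrow> bool" where
  "feeds i j \<longleftrightarrow> (\<exists>N::nat. \<exists>\<delta>>0. \<forall>T \<alpha> z s. nonneg_solution T \<alpha> z \<longrightarrow> 0 \<le> s \<longrightarrow> s + real N \<le> T \<longrightarrow>
     \<delta> * z s $ j \<le> z (s + real N) $ i)"

lemma feeds_refl: "feeds i i"
  unfolding feeds_def by (rule exI[of _ 0], rule exI[of _ 1]) simp

lemma feeds_trans:
  assumes "feeds i k" "feeds k j"
  shows "feeds i j"
proof -
  obtain N :: nat and \<delta> where N: "0 < \<delta>" "\<And>T \<alpha> z s. nonneg_solution T \<alpha> z \<Longrightarrow> 0 \<le> s \<Longrightarrow>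
      s + real N \<le> T \<Longrightarrow> \<delta> * z s $ k \<le> z (s + real N) $ i"
    using assms(1) unfolding feeds_def by blast
  obtain N' :: nat and \<delta>' where N': "0 < \<delta>'" "\<And>T \<alpha> z s. nonneg_solution T \<alpha> z \<Longrightarrow> 0 \<le> s \<Longrightarrow>
      s + real N' \<le> T \<Longrightarrow> \<delta>' * z s $ j \<le> z (s + real N') $ k"
    using assms(2) unfolding feeds_def by blast
  have "(\<delta> * \<delta>') * z s $ j \<le> z (s + real (N' + N)) $ i"
    if "nonneg_solution T \<alpha> z" "0 \<le> s" "s + real (N' + N) \<le> T" for T \<alpha> z s
  proof -
    have "\<delta> * (\<delta>' * z s $ j) \<le> \<delta> * z (s + real N') $ k"
      by (intro mult_left_mono N'(2)[OF that(1,2)]) (use N(1) that in auto)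
    also have "\<dots> \<le> z (s + real N' + real N) $ i"
      by (intro N(2)[OF that(1)]) (use that in auto)
    finally show ?thesis by (simp add: algebra_simps)
  qed
  moreover have "0 < \<delta> * \<delta>'" using N N' by simp
  ultimately show ?thesis unfolding feeds_def by blast
qed

text \<open>The indices not fed by j form a set I without j. A nonzero entry from outside I into I
  would be positive and would extend the feeding chain by one step, so that block vanishes; a
  nonempty I would make the matrix reducible.\<close>

lemma feeds_all: "feeds i j"
proof (rule ccontr)
  assume ij: "\<not> feeds i j"
  define I where "I = {k. \<not> feeds k j}"
  have "I \<noteq> {}" "I \<noteq> UNIV" using ij feeds_refl[of j] unfolding I_def by auto
  moreover have "(G + a *\<^sub>R F) $ k $ l = 0" if "k \<in> I" "l \<in> - I" for k l
  proof (rule ccontr)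
    assume n0: "(G + a *\<^sub>R F) $ k $ l \<noteq> 0"
    have kl: "k \<noteq> l" using that by auto
    then have "0 \<le> (G + a *\<^sub>R F) $ k $ l"
      using metzler_G metzler_F a_pos unfolding metzler_def by simp
    with n0 have pos: "0 < (G + a *\<^sub>R F) $ k $ l" by simp
    have "feeds k l"
      unfolding feeds_def
      by (rule exI[of _ 1], rule exI[of _ "(G + a *\<^sub>R F) $ k $ l"])
        (use nonneg_solution_step[OF _ _ _ kl] pos in auto)
    then have "feeds k j" using feeds_trans that unfolding I_def by auto
    with that show False unfolding I_def by simp
  qed
  ultimately show False using irreducible unfolding reducible_def by blast
qed

text \<open>There are finitely many pairs of indices, so the largest delay and the smallest factor
  serve all of them. Monotonicity bridges the gap between an individual delay and the common time
  N.\<close>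

lemma uniform_positivity:
  obtains N :: nat and \<delta> :: real where "0 < \<delta>"
    "\<And>T \<alpha> z i j. nonneg_solution T \<alpha> z \<Longrightarrow> real N \<le> T \<Longrightarrow> \<delta> * z 0 $ j \<le> z (real N) $ i"
proof -
  have "\<forall>p. \<exists>q :: nat \<times> real. 0 < snd q \<and> (\<forall>T \<alpha> z s. nonneg_solution T \<alpha> z \<longrightarrow> 0 \<le> s \<longrightarrow>
      s + real (fst q) \<le> T \<longrightarrow> snd q * z s $ snd p \<le> z (s + real (fst q)) $ fst p)"
    using feeds_all unfolding feeds_def by simp
  then obtain q :: "'n \<times> 'n \<Rightarrow> nat \<times> real" where q: "\<And>p. 0 < snd (q p)"
    "\<And>p T \<alpha> z s. nonneg_solution T \<alpha> z \<Longrightarrow> 0 \<le> s \<Longrightarrow> s + real (fst (q p)) \<le> T \<Longrightarrow>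
       snd (q p) * z s $ snd p \<le> z (s + real (fst (q p))) $ fst p"
    by metis
  define N where "N = Max (range (\<lambda>p. fst (q p)))"
  define \<delta> where "\<delta> = Min (range (\<lambda>p. snd (q p)))"
  have N: "fst (q p) \<le> N" and \<delta>: "\<delta> \<le> snd (q p)" for p
    unfolding N_def \<delta>_def by auto
  show ?thesis
  proof (rule that[of \<delta> N])
    show "0 < \<delta>" unfolding \<delta>_def using q(1) by auto
    fix T \<alpha> z i j assume z: "nonneg_solution T \<alpha> z" and T: "real N \<le> T"
    have NT: "real (fst (q (i, j))) \<le> real N" using N[of "(i,j)"] by simp
    have "\<delta> * z 0 $ j \<le> snd (q (i, j)) * z 0 $ j"
      using z T by (intro mult_right_mono \<delta>) (auto simp: nonneg_solution_def)
    also have "\<dots> \<le> z (real (fst (q (i, j)))) $ i"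
      using q(2)[OF z, of 0 "(i, j)"] NT T by simp
    also have "\<dots> \<le> z (real N) $ i"
      using nonneg_solution_mono[OF z _ NT T] by simp
    finally show "\<delta> * z 0 $ j \<le> z (real N) $ i" .
  qed
qed

end

section \<open>Endpoint values and discounted integrals\<close>

text \<open>A control repeated periodically can differ from the original at the right end of a
  period. Two endpoint values do not affect the integral, and adding their norms keeps the pointwise
  bound.\<close>

lemma bounded_primitive_spike:
  assumes "bounded_primitive T w x" "\<And>t. t \<in> {0<..<T} \<Longrightarrow> w t = w' t"
  shows "bounded_primitive T w' x"
proof -
  obtain B where B: "0 \<le> B" "\<And>t. t \<in> {0..T} \<Longrightarrow> norm (w t) \<le> B"
    using bounded_primitive_bound[OF assms(1)] by metis
  show ?thesis
  proof (rule bounded_primitiveI)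
    show "norm (w' t) \<le> B + norm (w' 0) + norm (w' T)" if t: "t \<in> {0..T}" for t
    proof -
      consider "t = 0" | "t = T" | "t \<in> {0<..<T}" using t by force
      then show ?thesis
      proof cases
        case 3
        then show ?thesis using B(2)[OF t, unfolded assms(2)[OF 3]] norm_ge_zero[of "w' 0"] norm_ge_zero[of "w' T"]
          by linarith
      qed (use B in auto)
    qed
    show "(w' has_integral x t - x 0) {0..t}" if t: "t \<in> {0..T}" for t
    proof (rule has_integral_spike_finite)
      show "finite {0, T}" by simp
      show "(w has_integral x t - x 0) {0..t}"
        using assms(1) t unfolding bounded_primitive_def by blast
      show "w' r = w r" if "r \<in> {0..t} - {0, T}" for r
        using that t assms(2)[of r] by auto
    qed
  qed
qed

text \<open>Integration by parts, in the form that the defect \<open>\<psi>\<close> is nonincreasing.\<close>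

lemma discounted_integral_le:
  fixes l :: "real \<Rightarrow> real"
  assumes cont: "\<And>t. continuous_on {0..t} l" and e: "0 < \<epsilon>" and t: "0 \<le> t"
    and le: "\<And>t. 0 \<le> t \<Longrightarrow> integral {0..t} l \<le> \<sigma> * t + D"
  shows "integral {0..t} (\<lambda>s. exp (- \<epsilon> * s) * l s) \<le> D + \<sigma> * (1 - exp (- \<epsilon> * t)) / \<epsilon>"
proof -
  define L where "L t = integral {0..t} l" for t
  define P where "P t = integral {0..t} (\<lambda>s. exp (- \<epsilon> * s) * l s)" for t
  \<comment> \<open>The subtracted terms are a boundary term and \<open>\<sigma>\<close> times the
    integral of the discount factor. They are arranged so that \<open>l\<close> cancels in the
    derivative, leaving \<open>\<epsilon> * exp (- \<epsilon> * s)\<close> times the nonpositive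
    excess \<open>L s - \<sigma> * s - D\<close>.\<close>
  define \<psi> where "\<psi> s = P s - exp (- \<epsilon> * s) * (L s - \<sigma> * s - D) - \<sigma> * (1 - exp (- \<epsilon> * s)) / \<epsilon>" for s
  have int: "((\<lambda>s. \<epsilon> * exp (- \<epsilon> * s) * (L s - \<sigma> * s - D)) has_integral \<psi> t - \<psi> 0) {0..t}"
  proof (rule fundamental_theorem_of_calculus[OF t])
    fix s assume s: "s \<in> {0..t}"
    have L': "(L has_real_derivative l s) (at s within {0..t})"
      unfolding has_real_derivative_iff_has_vector_derivative L_def[abs_def]
      by (rule integral_has_vector_derivative[OF cont s])
    have P': "(P has_real_derivative exp (- \<epsilon> * s) * l s) (at s within {0..t})"
      unfolding has_real_derivative_iff_has_vector_derivative P_def[abs_def]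
      by (rule integral_has_vector_derivative[OF _ s]) (intro continuous_intros cont)
    have "(\<psi> has_real_derivative \<epsilon> * exp (- \<epsilon> * s) * (L s - \<sigma> * s - D)) (at s within {0..t})"
      unfolding \<psi>_def[abs_def]
      by (rule derivative_eq_intros L' P' refl)+ (use e in \<open>simp_all add: field_simps\<close>)
    then show "(\<psi> has_vector_derivative \<epsilon> * exp (- \<epsilon> * s) * (L s - \<sigma> * s - D)) (at s within {0..t})"
      by (simp add: has_real_derivative_iff_has_vector_derivative)
  qed
  have "\<psi> t - \<psi> 0 \<le> 0"
  proof (rule has_integral_le[OF int has_integral_0])
    show "\<epsilon> * exp (- \<epsilon> * s) * (L s - \<sigma> * s - D) \<le> 0" if "s \<in> {0..t}" for s
      using le[of s] that e unfolding L_def by (intro mult_nonneg_nonpos) auto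
  qed
  moreover have "\<psi> 0 = D" by (simp add: \<psi>_def P_def L_def)
  moreover have "exp (- \<epsilon> * t) * (L t - \<sigma> * t - D) \<le> 0"
    using le[OF t] unfolding L_def by (intro mult_nonneg_nonpos) auto
  ultimately show ?thesis unfolding \<psi>_def P_def by linarith
qed

text \<open>The half-line is cut at n: the head obeys the finite-horizon estimate, the tail is at
  most B exp (- \<epsilon> n) / \<epsilon>, and n tends to infinity. After multiplication by
  \<epsilon> the growth slope \<sigma> remains and the offset D is damped to \<epsilon> D.\<close>

lemma laplace_transform_le:
  fixes l :: "real \<Rightarrow> real"
  assumes cont: "continuous_on {0..} l" and bound: "\<And>t. 0 \<le> t \<Longrightarrow> \<bar>l t\<bar> \<le> B" and e: "0 < \<epsilon>"
    and le: "\<And>t. 0 \<le> t \<Longrightarrow> integral {0..t} l \<le> \<sigma> * t + D"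
  shows "(LINT t:{0<..}|lebesgue. exp (- \<epsilon> * t) * l t) \<le> \<sigma> / \<epsilon> + D"
proof -
  let ?f = "\<lambda>t. exp (- \<epsilon> * t) * l t"
  have fb: "norm (?f t) \<le> B * exp (- \<epsilon> * t)" if "0 \<le> t" for t
    using mult_right_mono[OF bound[OF that], of "exp (- \<epsilon> * t)"] by (simp add: abs_mult mult.commute)
  have fc: "continuous_on {0..} ?f" by (intro continuous_intros cont)
  have ei: "(\<lambda>t. B * exp (- \<epsilon> * t)) integrable_on {c..}" for c
    using integrable_on_exp_minus_to_infinity[OF e, of c] by (intro integrable_on_mult_right)
  have S: "{0::real..} \<in> sets lebesgue" by (rule sets_completionI_sets) simp
  have fa: "?f absolutely_integrable_on {0..}"
    by (rule measurable_bounded_by_integrable_imp_absolutely_integrable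
        [OF continuous_imp_measurable_on_sets_lebesgue[OF fc S] S ei fb]) simp
  have fi: "?f integrable_on {0..}" using fa by (simp add: set_lebesgue_integral_eq_integral)
  have fa': "?f absolutely_integrable_on {0<..}"
    by (rule set_integrable_subset[OF fa]) auto
  have "(LINT t:{0<..}|lebesgue. ?f t) = integral {0<..} ?f"
    by (rule set_lebesgue_integral_eq_integral[OF fa'])
  also have "\<dots> = integral {0..} ?f"
    by (rule integral_spike_set; rule negligible_subset[of "{0}"]) auto
  finally have eq: "(LINT t:{0<..}|lebesgue. ?f t) = integral {0..} ?f" .
  have le': "integral {0..} ?f \<le> D + \<sigma> * (1 - exp (- \<epsilon> * real n)) / \<epsilon> + B * (exp (- \<epsilon> * real n) / \<epsilon>)" for n
  proof -
    have fin: "?f integrable_on {real n..}"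
      using fa by (intro set_lebesgue_integral_eq_integral(1) set_integrable_subset[OF fa]) auto
    have fi0: "?f integrable_on {0..real n}"
      using fa by (intro set_lebesgue_integral_eq_integral(1) set_integrable_subset[OF fa]) auto
    have "(?f has_integral integral {0..real n} ?f + integral {real n..} ?f) ({0..real n} \<union> {real n..})"
      by (rule has_integral_Un[OF integrable_integral[OF fi0] integrable_integral[OF fin]])
        (rule negligible_subset[of "{real n}"], auto)
    moreover have "{0..real n} \<union> {real n..} = {0..}" by auto
    ultimately have "integral {0..} ?f = integral {0..real n} ?f + integral {real n..} ?f"
      by (metis integral_unique)
    moreover have "integral {0..real n} ?f \<le> D + \<sigma> * (1 - exp (- \<epsilon> * real n)) / \<epsilon>"
      by (rule discounted_integral_le[OF _ e _ le]) (auto intro: continuous_on_subset[OF cont])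
    moreover have "norm (integral {real n..} ?f) \<le> integral {real n..} (\<lambda>t. B * exp (- \<epsilon> * t))"
      by (rule integral_norm_bound_integral[OF fin ei]) (use fb in auto)
    moreover have "integral {real n..} (\<lambda>t. B * exp (- \<epsilon> * t)) = B * (exp (- \<epsilon> * real n) / \<epsilon>)"
      by (intro integral_unique has_integral_mult_right has_integral_exp_minus_to_infinity e)
    ultimately show ?thesis by simp
  qed
  have lim: "(\<lambda>n. exp (- \<epsilon> * real n)) \<longlonglongrightarrow> 0"
  proof -
    have "(\<lambda>n. exp (- \<epsilon>) ^ n) \<longlonglongrightarrow> 0" by (rule LIMSEQ_power_zero) (use e in simp)
    then show ?thesis by (simp add: exp_of_nat_mult[symmetric] mult.commute)
  qed
  have "(\<lambda>n. D + \<sigma> * (1 - exp (- \<epsilon> * real n)) / \<epsilon> + B * (exp (- \<epsilon> * real n) / \<epsilon>)) \<longlonglongrightarrow>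
      D + \<sigma> * (1 - 0) / \<epsilon> + B * (0 / \<epsilon>)"
    by (intro tendsto_intros lim) (use e in auto)
  then have "integral {0..} ?f \<le> D + \<sigma> * (1 - 0) / \<epsilon> + B * (0 / \<epsilon>)"
    by (rule LIMSEQ_le_const) (use le' in auto)
  then show ?thesis unfolding eq by simp
qed

lemma laplace_transform_ge:
  fixes l :: "real \<Rightarrow> real"
  assumes cont: "continuous_on {0..} l" and bound: "\<And>t. 0 \<le> t \<Longrightarrow> \<bar>l t\<bar> \<le> B" and e: "0 < \<epsilon>"
    and ge: "\<And>t. 0 \<le> t \<Longrightarrow> \<sigma> * t - D \<le> integral {0..t} l"
  shows "\<sigma> / \<epsilon> - D \<le> (LINT t:{0<..}|lebesgue. exp (- \<epsilon> * t) * l t)"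
proof -
  have "(LINT t:{0<..}|lebesgue. exp (- \<epsilon> * t) * - l t) \<le> (- \<sigma>) / \<epsilon> + D"
  proof (rule laplace_transform_le[OF _ _ e])
    show "continuous_on {0..} (\<lambda>t. - l t)" by (intro continuous_intros cont)
    show "\<bar>- l t\<bar> \<le> B" if "0 \<le> t" for t using bound[OF that] by simp
    show "integral {0..t} (\<lambda>t. - l t) \<le> - \<sigma> * t + D" if "0 \<le> t" for t
      using ge[OF that] by simp
  qed
  then show ?thesis by (simp add: set_lebesgue_integral_def)
qed

text \<open>Two approximants \<sigma> can be compared through one value of f. Since neither they nor
  their constants D depend on \<epsilon>, letting \<epsilon> tend to 0 leaves only the C / T errors,
  so the approximants along integer T form a Cauchy sequence.\<close>

lemma uniform_limit_const_of_approx: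
  fixes f :: "real \<Rightarrow> 'b \<Rightarrow> real"
  assumes approx: "\<And>T. 0 < T \<Longrightarrow> \<exists>\<sigma> D. \<forall>\<epsilon>>0. \<forall>y\<in>Y. \<bar>f \<epsilon> y - \<sigma>\<bar> \<le> C / T + \<epsilon> * D" and C: "0 \<le> C"
  shows "\<exists>l. uniform_limit Y f (\<lambda>_. l) (at_right 0)"
proof (cases "Y = {}")
  case True then show ?thesis by simp
next
  case False
  then obtain y0 where y0: "y0 \<in> Y" by auto
  have "\<forall>n. \<exists>\<sigma> D. \<forall>\<epsilon>>0. \<forall>y\<in>Y. \<bar>f \<epsilon> y - \<sigma>\<bar> \<le> C / real (Suc n) + \<epsilon> * D"
    using approx by simp
  then obtain \<sigma> D where *: "\<And>n \<epsilon> y. 0 < \<epsilon> \<Longrightarrow> y \<in> Y \<Longrightarrow> \<bar>f \<epsilon> y - \<sigma> n\<bar> \<le> C / real (Suc n) + \<epsilon> * D n"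
    by metis
  have diff: "\<bar>\<sigma> n - \<sigma> k\<bar> \<le> C / real (Suc n) + C / real (Suc k)" for n k
  proof (rule field_le_epsilon)
    fix e :: real assume e: "0 < e"
    \<comment> \<open>Chosen so that the error terms of the two indices n and k add up to at most
      e.\<close>
    define \<epsilon> where "\<epsilon> = e / (\<bar>D n\<bar> + \<bar>D k\<bar> + 1)"
    have \<epsilon>: "0 < \<epsilon>" unfolding \<epsilon>_def using e by (intro divide_pos_pos) auto
    have "\<epsilon> * D n + \<epsilon> * D k \<le> \<epsilon> * (\<bar>D n\<bar> + \<bar>D k\<bar> + 1)"
      using \<epsilon> by (simp add: distrib_left[symmetric])
    also have "\<dots> = e" unfolding \<epsilon>_def by (simp add: abs_add_one_gt_zero add_nonneg_eq_0_iff)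
    finally show "\<bar>\<sigma> n - \<sigma> k\<bar> \<le> C / real (Suc n) + C / real (Suc k) + e"
      using *[OF \<epsilon> y0, of n] *[OF \<epsilon> y0, of k] by linarith
  qed
  have C0: "(\<lambda>n. C / real (Suc n)) \<longlonglongrightarrow> 0"
    using tendsto_mult[OF tendsto_const[of C] LIMSEQ_inverse_real_of_nat] by (simp add: divide_inverse)
  have "Cauchy \<sigma>"
  proof (rule CauchyI)
    fix e :: real assume "0 < e"
    then have "0 < e / 2" by simp
    from order_tendstoD(2)[OF C0 this] obtain N where N: "\<And>n. n \<ge> N \<Longrightarrow> C / real (Suc n) < e / 2"
      unfolding eventually_sequentially by blast
    show "\<exists>M. \<forall>n\<ge>M. \<forall>k\<ge>M. norm (\<sigma> n - \<sigma> k) < e"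
    proof (intro exI[of _ N] allI impI)
      fix n k assume "N \<le> n" "N \<le> k"
      then have "\<bar>\<sigma> n - \<sigma> k\<bar> < e" using diff[of n k] N[of n] N[of k] by linarith
      then show "norm (\<sigma> n - \<sigma> k) < e" by simp
    qed
  qed
  then obtain l where l: "\<sigma> \<longlonglongrightarrow> l" using Cauchy_convergent convergent_def by blast
  have "uniform_limit Y f (\<lambda>_. l) (at_right 0)"
  proof (rule uniform_limitI)
    fix e :: real assume e: "0 < e"
    have "\<forall>\<^sub>F n in sequentially. C / real (Suc n) < e / 3 \<and> dist (\<sigma> n) l < e / 3"
      using e by (intro eventually_conj order_tendstoD(2)[OF C0] tendstoD[OF l]) auto
    then obtain n where n: "C / real (Suc n) < e / 3" "dist (\<sigma> n) l < e / 3"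
      unfolding eventually_sequentially by blast
    \<comment> \<open>The index n is fixed before d, because \<open>D n\<close> may grow with n;
      then \<open>\<epsilon> * D n\<close> stays below the last third of e.\<close>
    define d where "d = e / (3 * (\<bar>D n\<bar> + 1))"
    have d: "0 < d" unfolding d_def using e by (intro divide_pos_pos) auto
    show "\<forall>\<^sub>F \<epsilon> in at_right 0. \<forall>y\<in>Y. dist (f \<epsilon> y) l < e"
      unfolding eventually_at_right_field
    proof (intro exI[of _ d] conjI allI impI ballI d)
      fix \<epsilon> y assume \<epsilon>: "0 < \<epsilon>" "\<epsilon> < d" and y: "y \<in> Y"
      have "\<epsilon> * D n \<le> d * (\<bar>D n\<bar> + 1)"
        using \<epsilon> d by (intro order_trans[OF mult_left_mono[OF abs_ge_self] mult_mono]) auto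
      also have "\<dots> = e / 3" unfolding d_def by (simp add: field_simps)
      finally show "dist (f \<epsilon> y) l < e"
        using *[OF \<epsilon>(1) y, of n] n unfolding dist_real_def by linarith
    qed
  qed
  then show ?thesis ..
qed

section \<open>Accumulated growth along controlled paths\<close>

text \<open>The exponent of the lift. As \<open>m \<bullet> y t = 1\<close> on the simplex, it is
  the logarithm of the mass of the lifted solution, up to the explicit term c t.\<close>

definition total_growth :: "real^'n^'n \<Rightarrow> real^'n \<Rightarrow> (real \<Rightarrow> real^'n) \<Rightarrow> real \<Rightarrow> real" where
  "total_growth G m y t = integral {0..t} (\<lambda>s. growth_rate G m (y s))"

text \<open>A finite-horizon counterpart of \<open>trajectory\<close>, phrased with primitives so
  that it can be shifted and compared period by period.\<close>

definition controlled_path ::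
  "real^'n^'n \<Rightarrow> real^'n^'n \<Rightarrow> real^'n \<Rightarrow> real \<Rightarrow> (real \<Rightarrow> real) \<Rightarrow> (real \<Rightarrow> real^'n) \<Rightarrow> bool" where
  "controlled_path G F m T \<alpha> y \<longleftrightarrow> (\<forall>t\<in>{0..T}. y t \<in> simplex_of m) \<and>
     bounded_primitive T (\<lambda>t. drift G F m (y t) (\<alpha> t)) y"

lemma controlled_path_continuous: "controlled_path G F m T \<alpha> y \<Longrightarrow> continuous_on {0..T} y"
  unfolding controlled_path_def by (blast intro: bounded_primitive_continuous)

lemma continuous_on_growth_rate:
  assumes "continuous_on S y"
  shows "continuous_on S (\<lambda>t. growth_rate G m (y t))"
proof -
  have "continuous_on S (\<lambda>t. G *v y t)"
    by (rule bounded_linear.continuous_on[OF matrix_vector_mul_bounded_linear assms])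
  then show ?thesis unfolding growth_rate_def by (intro continuous_intros)
qed

lemma growth_rate_scaleR: "growth_rate G m (r *\<^sub>R y) = r * growth_rate G m y"
  by (simp add: growth_rate_def matrix_vector_mult_scaleR)

lemma controlled_path_spike:
  assumes "controlled_path G F m T \<alpha> y" "\<And>t. t \<in> {0<..<T} \<Longrightarrow> \<alpha> t = \<beta> t"
  shows "controlled_path G F m T \<beta> y"
  using assms unfolding controlled_path_def by (auto intro: bounded_primitive_spike)

lemma controlled_path_shift:
  assumes "controlled_path G F m (s + T) \<alpha> y" "0 \<le> s"
  shows "controlled_path G F m T (\<lambda>t. \<alpha> (s + t)) (\<lambda>t. y (s + t))"
  using assms bounded_primitive_shift[of s T "\<lambda>t. drift G F m (y t) (\<alpha> t)" y]
  unfolding controlled_path_def by auto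

lemma total_growth_shift:
  assumes "continuous_on {0..s + t} y" "0 \<le> s" "0 \<le> t"
  shows "total_growth G m y (s + t) = total_growth G m y s + total_growth G m (\<lambda>r. y (s + r)) t"
proof -
  let ?l = "\<lambda>r. growth_rate G m (y r)"
  have i: "?l integrable_on {u..v}" if "0 \<le> u" "v \<le> s + t" for u v
    by (intro integrable_continuous_real continuous_on_growth_rate continuous_on_subset[OF assms(1)])
      (use that in auto)
  have "((\<lambda>r. ?l (r + s)) has_integral integral {s..s+t} ?l) {s - s..s + t - s}"
    by (intro has_integral_shift_real_ivl integrable_integral i) (use assms in auto)
  then have "integral {0..t} (\<lambda>r. ?l (s + r)) = integral {s..s+t} ?l"
    by (simp add: integral_unique add.commute)
  then show ?thesis
    unfolding total_growth_def
    using Henstock_Kurzweil_Integration.integral_combine[of 0 s "s + t" ?l] i assms by simp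
qed

lemma has_integral_Ioc_iff_Icc:
  fixes f :: "real \<Rightarrow> 'a::euclidean_space"
  shows "(f has_integral I) {s<..t} \<longleftrightarrow> (f has_integral I) {s..t}"
  by (rule has_integral_spike_set_eq; rule negligible_subset[of "{s}"]) auto

section \<open>Paths on the simplex as projections of linear solutions\<close>

context controlled_metzler
begin

lemma m_nonneg: "0 \<le> m $ i"
  using m_pos[of i] by simp

lemma simplex_le:
  assumes "y \<in> simplex_of m"
  shows "y $ i \<le> 1 / m $ i"
proof -
  have "m $ i * y $ i \<le> (\<Sum>i\<in>UNIV. m $ i * y $ i)"
    by (rule member_le_sum[of i UNIV "\<lambda>i. m $ i * y $ i"])
      (use assms m_nonneg in \<open>auto simp: simplex_of_def intro!: mult_nonneg_nonneg\<close>)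
  also have "\<dots> = 1" using assms by (simp add: simplex_of_def inner_vec_def)
  finally show ?thesis using m_pos[of i] by (simp add: field_simps)
qed

lemma simplex_norm_bound:
  obtains R where "0 \<le> R" "\<And>y. y \<in> simplex_of m \<Longrightarrow> norm y \<le> R"
proof (rule that)
  show "0 \<le> (\<Sum>i\<in>UNIV. 1 / m $ i)" using m_pos by (intro sum_nonneg) (simp add: less_imp_le)
  fix y assume y: "y \<in> simplex_of m"
  have "norm y \<le> (\<Sum>i\<in>UNIV. \<bar>y $ i\<bar>)" by (rule norm_le_l1_cart)
  also have "\<dots> \<le> (\<Sum>i\<in>UNIV. 1 / m $ i)"
    by (rule sum_mono) (use y simplex_le[OF y] in \<open>auto simp: simplex_of_def\<close>)
  finally show "norm y \<le> (\<Sum>i\<in>UNIV. 1 / m $ i)" .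
qed

lemma growth_rate_bound:
  obtains B where "0 \<le> B" "\<And>y. y \<in> simplex_of m \<Longrightarrow> \<bar>growth_rate G m y\<bar> \<le> B"
proof -
  obtain R where R: "0 \<le> R" "\<And>y. y \<in> simplex_of m \<Longrightarrow> norm y \<le> R"
    using simplex_norm_bound by blast
  obtain K where K: "0 \<le> K" "\<And>z. norm (G *v z) \<le> norm z * K"
    using bounded_linear.nonneg_bounded[OF matrix_vector_mul_bounded_linear[of G]] by blast
  show ?thesis
  proof (rule that)
    show "0 \<le> norm m * (R * K)" using R K by simp
    fix y assume y: "y \<in> simplex_of m"
    have "\<bar>growth_rate G m y\<bar> \<le> norm m * norm (G *v y)"
      unfolding growth_rate_def by (rule Cauchy_Schwarz_ineq2)
    also have "\<dots> \<le> norm m * (norm y * K)" by (intro mult_left_mono K) simp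
    also have "\<dots> \<le> norm m * (R * K)" by (intro mult_left_mono mult_right_mono R y K) simp
    finally show "\<bar>growth_rate G m y\<bar> \<le> norm m * (R * K)" .
  qed
qed

lemma drift_eq: "drift G F m y x = gen x *v y - (shift_const + growth_rate G m y) *\<^sub>R y"
  by (simp add: drift_def gen_mult growth_rate_def matrix_vector_mult_add_rdistrib
      scaleR_matrix_vector_assoc scaleR_add_left)

text \<open>Pairing with m removes the control, since \<open>m v* F = 0\<close>. The rate of change
  of the mass is therefore continuous in time even under a discontinuous control.\<close>

lemma inner_gen: "m \<bullet> (gen x *v z) = growth_rate G m z + shift_const * (m \<bullet> z)"
proof -
  have "m \<bullet> (F *v z) = 0" using m_F by (simp add: dot_lmul_matrix[symmetric])
  then show ?thesis by (simp add: gen_mult growth_rate_def inner_add_right)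
qed

lemma drift_bound:
  obtains B where "0 \<le> B" "\<And>y x. y \<in> simplex_of m \<Longrightarrow> x \<in> {a..A} \<Longrightarrow> norm (drift G F m y x) \<le> B"
proof -
  obtain R where R: "0 \<le> R" "\<And>y. y \<in> simplex_of m \<Longrightarrow> norm y \<le> R"
    using simplex_norm_bound by blast
  obtain K where K: "0 \<le> K" "\<And>x z. x \<in> {a..A} \<Longrightarrow> norm (gen x *v z) \<le> K * norm z"
    using gen_norm_bound by blast
  obtain B where B: "0 \<le> B" "\<And>y. y \<in> simplex_of m \<Longrightarrow> \<bar>growth_rate G m y\<bar> \<le> B"
    using growth_rate_bound by blast
  show ?thesis
  proof (rule that)
    show "0 \<le> K * R + (shift_const + B) * R" using K R B shift_const_nonneg by simp
    fix y x assume y: "y \<in> simplex_of m" and x: "x \<in> {a..A}"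
    have "norm (drift G F m y x) \<le> norm (gen x *v y) + norm ((shift_const + growth_rate G m y) *\<^sub>R y)"
      unfolding drift_eq by (rule norm_triangle_ineq4)
    also have "\<dots> \<le> K * R + (shift_const + B) * R"
    proof (rule add_mono)
      show "norm (gen x *v y) \<le> K * R"
        using K(2)[OF x, of y] mult_left_mono[OF R(2)[OF y] K(1)] by simp
      have "\<bar>shift_const + growth_rate G m y\<bar> \<le> shift_const + B"
        using B(2)[OF y] shift_const_nonneg by linarith
      then show "norm ((shift_const + growth_rate G m y) *\<^sub>R y) \<le> (shift_const + B) * R"
        using R(2)[OF y] by (auto intro!: mult_mono)
    qed
    finally show "norm (drift G F m y x) \<le> K * R + (shift_const + B) * R" .
  qed
qed

text \<open>On the simplex, with controls in [a, A], the drift is uniformly bounded. Hence gauge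
  integrability on a bounded interval upgrades to Lebesgue integrability, and the two formulations
  coincide.\<close>

lemma trajectory_iff_path:
  assumes \<alpha>: "control \<alpha>"
  shows "trajectory G F m \<alpha> y \<longleftrightarrow> (\<forall>T. controlled_path G F m T \<alpha> y)"
proof
  obtain B where B: "0 \<le> B" "\<And>y x. y \<in> simplex_of m \<Longrightarrow> x \<in> {a..A} \<Longrightarrow> norm (drift G F m y x) \<le> B"
    using drift_bound by blast
  show "\<forall>T. controlled_path G F m T \<alpha> y" if "trajectory G F m \<alpha> y"
  proof
    fix T
    have s: "y t \<in> simplex_of m"
      and i: "set_integrable lebesgue {0<..t} (\<lambda>s. drift G F m (y s) (\<alpha> s))"
      and e: "y t = y 0 + (LINT s:{0<..t}|lebesgue. drift G F m (y s) (\<alpha> s))" if "0 \<le> t" for t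
      using \<open>trajectory G F m \<alpha> y\<close> that unfolding trajectory_def by blast+
    have "bounded_primitive T (\<lambda>t. drift G F m (y t) (\<alpha> t)) y"
    proof (rule bounded_primitiveI)
      show "norm (drift G F m (y t) (\<alpha> t)) \<le> B" if "t \<in> {0..T}" for t
        using that by (intro B s controlD[OF \<alpha>]) auto
      fix t assume "t \<in> {0..T}"
      then have "0 \<le> t" by simp
      have "((\<lambda>s. drift G F m (y s) (\<alpha> s)) has_integral y t - y 0) {0<..t}"
        using has_integral_set_lebesgue[OF i[OF \<open>0 \<le> t\<close>]] e[OF \<open>0 \<le> t\<close>] by (simp add: algebra_simps)
      then show "((\<lambda>s. drift G F m (y s) (\<alpha> s)) has_integral y t - y 0) {0..t}"
        unfolding has_integral_Ioc_iff_Icc .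
    qed
    with s show "controlled_path G F m T \<alpha> y" unfolding controlled_path_def by auto
  qed
  show "trajectory G F m \<alpha> y" if p: "\<forall>T. controlled_path G F m T \<alpha> y"
    unfolding trajectory_def
  proof (intro allI impI conjI)
    fix t :: real assume t: "0 \<le> t"
    have pt: "\<forall>s\<in>{0..t}. y s \<in> simplex_of m"
      "bounded_primitive t (\<lambda>s. drift G F m (y s) (\<alpha> s)) y"
      using p unfolding controlled_path_def by blast+
    show "y t \<in> simplex_of m" using pt t by auto
    have hi: "((\<lambda>s. drift G F m (y s) (\<alpha> s)) has_integral y t - y 0) {0..t}"
      using pt(2) t unfolding bounded_primitive_def by auto
    have "(\<lambda>s. drift G F m (y s) (\<alpha> s)) absolutely_integrable_on {0..t}"
      by (rule absolutely_integrable_integrable_bound[of _ _ "\<lambda>_. B"])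
        (use hi pt(1) B(2) controlD[OF \<alpha>] in auto)
    then show si: "(\<lambda>s. drift G F m (y s) (\<alpha> s)) absolutely_integrable_on {0<..t}"
      by (rule set_integrable_subset) auto
    have "((\<lambda>s. drift G F m (y s) (\<alpha> s)) has_integral y t - y 0) {0<..t}"
      unfolding has_integral_Ioc_iff_Icc by (rule hi)
    from has_integral_unique[OF this has_integral_set_lebesgue[OF si]]
    show "y t = y 0 + (LINT s:{0<..t}|lebesgue. drift G F m (y s) (\<alpha> s))"
      by (simp add: algebra_simps)
  qed
qed

text \<open>The exponential factor is continuously differentiable because the growth rate is
  continuous along the path, so the product rule applies. Its logarithmic derivative cancels exactly
  the scalar term subtracted in \<open>drift_eq\<close>.\<close>

lemma controlled_path_imp_linear_solution:
  assumes p: "controlled_path G F m T \<alpha> y"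
  shows "linear_solution T \<alpha> (\<lambda>t. exp (shift_const * t + total_growth G m y t) *\<^sub>R y t)"
proof -
  define E where "E t = exp (shift_const * t + total_growth G m y t)" for t
  have lc: "continuous_on {0..T} (\<lambda>t. growth_rate G m (y t))"
    by (rule continuous_on_growth_rate[OF controlled_path_continuous[OF p]])
  have tg: "(total_growth G m y has_real_derivative growth_rate G m (y t)) (at t within {0..T})"
    if "t \<in> {0..T}" for t
    unfolding has_real_derivative_iff_has_vector_derivative total_growth_def[abs_def]
    by (rule integral_has_vector_derivative[OF lc that])
  have E': "(E has_real_derivative E t * (shift_const + growth_rate G m (y t))) (at t within {0..T})"
    if "t \<in> {0..T}" for t
    unfolding E_def[abs_def] by (rule derivative_eq_intros tg that refl)+ simp
  have Ec: "continuous_on {0..T} E" by (rule DERIV_continuous_on[OF E'])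
  have E'c: "continuous_on {0..T} (\<lambda>t. E t * (shift_const + growth_rate G m (y t)))"
    by (intro continuous_intros Ec lc)
  have "bounded_primitive T (\<lambda>t. E t * (shift_const + growth_rate G m (y t))) E"
    by (rule bounded_primitive_of_deriv[OF E'c])
      (use E' in \<open>simp add: has_real_derivative_iff_has_vector_derivative\<close>)
  from bounded_primitive_scaleR[OF this E'c p[unfolded controlled_path_def, THEN conjunct2]]
  have "bounded_primitive T (\<lambda>t. gen (\<alpha> t) *v (E t *\<^sub>R y t)) (\<lambda>t. E t *\<^sub>R y t)"
    by (rule bounded_primitive_cong)
      (simp_all add: drift_eq matrix_vector_mult_scaleR algebra_simps)
  then show ?thesis unfolding linear_solution_def E_def .
qed

text \<open>The linear equation is solved from y0 and the solution is divided by its mass q. The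
  mass has a control-free, continuous rate, so 1 / q can be the smooth factor in the product
  rule.\<close>

lemma controlled_path_exists:
  assumes \<alpha>: "control \<alpha>" and y0: "y0 \<in> simplex_of m"
  obtains y where "y 0 = y0" "\<And>T. controlled_path G F m T \<alpha> y"
proof -
  obtain z where z: "z 0 = y0" "\<And>T. linear_solution T \<alpha> z"
    using linear_solution_exists[OF \<alpha>] by metis
  have z0: "0 \<le> y0 $ i" for i using y0 by (simp add: simplex_of_def)
  have zn: "0 \<le> z t $ i" if "0 \<le> t" for t i
    using linear_solution_nonneg[OF \<alpha> z(2)[of t], of t i] z0 z(1) that by simp
  define q where "q t = m \<bullet> z t" for t
  \<comment> \<open>The mass equals 1 at time 0 and is nondecreasing thanks to the diagonal shift,
    so the division is safe.\<close>
  have qp: "1 \<le> q t" if t: "0 \<le> t" for t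
  proof -
    have "nonneg_solution t \<alpha> z" unfolding nonneg_solution_def using \<alpha> z zn by auto
    from nonneg_solution_mono[OF this, of 0 t] t
    have "m \<bullet> z 0 \<le> m \<bullet> z t"
      unfolding inner_vec_def using m_nonneg by (auto intro!: sum_mono mult_left_mono)
    then show ?thesis using y0 z(1) by (simp add: q_def simplex_of_def)
  qed
  define y where "y t = (1 / q t) *\<^sub>R z t" for t
  have "controlled_path G F m T \<alpha> y" for T
    unfolding controlled_path_def
  proof
    show "\<forall>t\<in>{0..T}. y t \<in> simplex_of m"
    proof
      fix t assume t: "t \<in> {0..T}"
      then have "0 < q t" using qp[of t] by simp
      moreover have "m \<bullet> y t = 1" using \<open>0 < q t\<close> by (simp add: y_def q_def)
      ultimately show "y t \<in> simplex_of m"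
        using zn t by (auto simp: simplex_of_def y_def)
    qed
    have zp: "bounded_primitive T (\<lambda>t. gen (\<alpha> t) *v z t) z"
      using z(2) unfolding linear_solution_def .
    have zc: "continuous_on {0..T} z" by (rule bounded_primitive_continuous[OF zp])
    let ?q' = "\<lambda>t. growth_rate G m (z t) + shift_const * q t"
    have qq: "bounded_primitive T ?q' q"
      using bounded_primitive_linear[OF bounded_linear_inner_right zp, of m]
      by (simp add: inner_gen q_def[abs_def])
    have qc: "continuous_on {0..T} q" by (rule bounded_primitive_continuous[OF qq])
    have q'c: "continuous_on {0..T} ?q'"
      by (intro continuous_intros qc continuous_on_growth_rate zc)
    have q': "(q has_real_derivative ?q' t) (at t within {0..T})" if "t \<in> {0..T}" for t
      using bounded_primitive_deriv[OF qq q'c that]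
      by (simp add: has_real_derivative_iff_has_vector_derivative)
    have qne: "q t \<noteq> 0" if "t \<in> {0..T}" for t using qp[of t] that by auto
    have i': "((\<lambda>t. 1 / q t) has_vector_derivative - ?q' t / (q t)^2) (at t within {0..T})"
      if "t \<in> {0..T}" for t
      unfolding has_real_derivative_iff_has_vector_derivative[symmetric]
      by (rule derivative_eq_intros q' that qne refl)+ (simp add: power2_eq_square)
    have i'c: "continuous_on {0..T} (\<lambda>t. - ?q' t / (q t)^2)"
      by (intro continuous_intros q'c qc) (use qne in auto)
    have "bounded_primitive T (\<lambda>t. (- ?q' t / (q t)^2) *\<^sub>R z t + (1 / q t) *\<^sub>R (gen (\<alpha> t) *v z t)) y"
      unfolding y_def
      by (rule bounded_primitive_scaleR[OF bounded_primitive_of_deriv[OF i'c i'] i'c zp])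
    then show "bounded_primitive T (\<lambda>t. drift G F m (y t) (\<alpha> t)) y"
    proof (rule bounded_primitive_cong)
      fix t assume t: "t \<in> {0..T}"
      \<comment> \<open>By homogeneity \<open>?q' t / q t\<close> equals
        \<open>growth_rate G m (y t) + shift_const\<close>, the coefficient in
        \<open>drift_eq\<close>.\<close>
      show "(- ?q' t / (q t)^2) *\<^sub>R z t + (1 / q t) *\<^sub>R (gen (\<alpha> t) *v z t) = drift G F m (y t) (\<alpha> t)"
        using qne[OF t] unfolding drift_eq y_def growth_rate_scaleR matrix_vector_mult_scaleR
        by (simp add: power2_eq_square scaleR_diff_left[symmetric] scaleR_add_left[symmetric] field_simps)
    qed simp
  qed
  moreover have "y 0 = y0" using y0 z(1) by (simp add: y_def q_def simplex_of_def)
  ultimately show ?thesis using that by blast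
qed

section \<open>Growth depends on the starting point only up to a constant\<close>

lemma total_growth_0 [simp]: "total_growth G m y 0 = 0"
  by (simp add: total_growth_def)

lemma total_growth_bound:
  assumes p: "controlled_path G F m T \<alpha> y" and B: "0 \<le> B" "\<And>y. y \<in> simplex_of m \<Longrightarrow> \<bar>growth_rate G m y\<bar> \<le> B"
    and T: "0 \<le> T"
  shows "\<bar>total_growth G m y T\<bar> \<le> B * T"
proof -
  have "(\<lambda>s. growth_rate G m (y s)) integrable_on {0..T}"
    by (intro integrable_continuous_real continuous_on_growth_rate controlled_path_continuous[OF p])
  then have "norm (total_growth G m y T) \<le> B * measure lborel (cbox 0 T)"
    unfolding total_growth_def
    by (intro has_integral_bound[OF B(1), of "\<lambda>s. growth_rate G m (y s)"])
      (use B p in \<open>auto simp: controlled_path_def\<close>)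
  then show ?thesis using T by simp
qed

lemma control_shift:
  assumes "control \<alpha>"
  shows "control (\<lambda>t. \<alpha> (s + t))"
  unfolding control_def
proof (intro conjI allI controlD[OF assms] measurableI)
  fix S :: "real set" assume S: "S \<in> sets borel"
  have "(\<lambda>t. \<alpha> (s + t)) -` S \<inter> space lebesgue = (+) (- s) ` (\<alpha> -` S)"
  proof (intro equalityI subsetI)
    fix t assume "t \<in> (\<lambda>t. \<alpha> (s + t)) -` S \<inter> space lebesgue"
    then show "t \<in> (+) (- s) ` (\<alpha> -` S)" by (intro image_eqI[of _ _ "s + t"]) auto
  qed auto
  also have "\<dots> \<in> sets lebesgue"
    using assms measurable_sets[of \<alpha> lebesgue borel S] S
    by (intro lebesgue_sets_translation) (simp add: control_def)
  finally show "(\<lambda>t. \<alpha> (s + t)) -` S \<inter> space lebesgue \<in> sets lebesgue" .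
qed simp

text \<open>At time N the lift of y' is bounded below in every component and the lift of y is
  bounded above, so some multiple Q of the former dominates the latter. Linearity and order
  preservation keep this true up to T; pairing with m and taking logarithms gives the offset ln
  Q.\<close>

lemma growth_comparison:
  obtains K where "0 \<le> K"
    "\<And>T \<alpha> y y'. 0 \<le> T \<Longrightarrow> control \<alpha> \<Longrightarrow> controlled_path G F m T \<alpha> y \<Longrightarrow> controlled_path G F m T \<alpha> y' \<Longrightarrow>
       total_growth G m y T \<le> total_growth G m y' T + K"
proof -
  obtain B where B: "0 \<le> B" "\<And>y. y \<in> simplex_of m \<Longrightarrow> \<bar>growth_rate G m y\<bar> \<le> B"
    using growth_rate_bound by blast
  obtain R where R: "0 \<le> R" "\<And>y. y \<in> simplex_of m \<Longrightarrow> norm y \<le> R"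
    using simplex_norm_bound by blast
  obtain N :: nat and \<delta> :: real where \<delta>: "0 < \<delta>"
    "\<And>T \<alpha> z i j. nonneg_solution T \<alpha> z \<Longrightarrow> real N \<le> T \<Longrightarrow> \<delta> * z 0 $ j \<le> z (real N) $ i"
    by (rule uniform_positivity) (rule that)
  \<comment> \<open>If all coordinates of a simplex point were below this value, its pairing with m
    would be less than 1.\<close>
  define \<kappa> where "\<kappa> = 1 / (\<Sum>i\<in>UNIV. m $ i)"
  have sum_pos: "0 < (\<Sum>i\<in>UNIV. m $ i)" using m_pos by (intro sum_pos) auto
  then have \<kappa>: "0 < \<kappa>" by (simp add: \<kappa>_def)
  have big: "\<exists>j. \<kappa> \<le> y $ j" if y: "y \<in> simplex_of m" for y
  proof (rule ccontr)
    assume "\<nexists>j. \<kappa> \<le> y $ j"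
    then have "(\<Sum>i\<in>UNIV. m $ i * y $ i) < (\<Sum>i\<in>UNIV. m $ i * \<kappa>)"
      using m_pos by (intro sum_strict_mono mult_strict_left_mono) (auto simp: not_le)
    also have "\<dots> = 1" using sum_pos by (simp add: \<kappa>_def sum_divide_distrib[symmetric])
    finally show False using y by (simp add: simplex_of_def inner_vec_def)
  qed
  define E where "E = exp ((shift_const + B) * real N)"
  have E: "0 \<le> E" by (simp add: E_def)
  \<comment> \<open>Solves Q \<delta> \<kappa> = E (R + 1), which equates the upper bound for z with
    Q times the lower bound for z' at time N. Using R + 1 keeps Q positive also when R = 0, so that
    ln Q is meaningful.\<close>
  define Q where "Q = E * (R + 1) / (\<delta> * \<kappa>)"
  have Q: "0 < Q" using \<kappa> \<delta> R by (simp add: Q_def E_def)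
  \<comment> \<open>The first summand handles horizons shorter than N, where each growth is at most
    B N in absolute value; the second handles the others, with an absolute value to keep K
    nonnegative.\<close>
  define K where "K = 2 * B * real N + \<bar>ln Q\<bar>"
  show ?thesis
  proof (rule that[of K])
    show "0 \<le> K" using B by (simp add: K_def)
    fix T \<alpha> y y'
    assume T: "0 \<le> T" and \<alpha>: "control \<alpha>" and p: "controlled_path G F m T \<alpha> y" and p': "controlled_path G F m T \<alpha> y'"
    show "total_growth G m y T \<le> total_growth G m y' T + K"
    proof (cases "T < real N")
      case True
      then have "B * T \<le> B * real N" using B by (intro mult_left_mono) auto
      then show ?thesis
        using total_growth_bound[OF p B T] total_growth_bound[OF p' B T] unfolding K_def by linarith
    next
      case False
      then have N: "real N \<le> T" by simp
      define z where "z t = exp (shift_const * t + total_growth G m y t) *\<^sub>R y t" for t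
      define z' where "z' t = exp (shift_const * t + total_growth G m y' t) *\<^sub>R y' t" for t
      have z: "linear_solution T \<alpha> z" and z': "linear_solution T \<alpha> z'"
        unfolding z_def z'_def by (intro controlled_path_imp_linear_solution p p')+
      have ys: "y t \<in> simplex_of m" and ys': "y' t \<in> simplex_of m" if "t \<in> {0..T}" for t
        using p p' that unfolding controlled_path_def by auto
      have n': "nonneg_solution T \<alpha> z'"
        unfolding nonneg_solution_def using \<alpha> z' ys' by (auto simp: z'_def simplex_of_def)
      obtain j where j: "\<kappa> \<le> y' 0 $ j" using big[OF ys'[of 0]] T by auto
      \<comment> \<open>This difference solves the linear equation with the control restarted at
        time N, so its nonnegativity has to be checked only at its own time 0.\<close>
      define w where "w t = Q *\<^sub>R z' (real N + t) - z (real N + t)" for t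
      have w: "linear_solution (T - real N) (\<lambda>t. \<alpha> (real N + t)) w"
      proof -
        have "bounded_primitive T (\<lambda>t. gen (\<alpha> t) *v (Q *\<^sub>R z' t - z t)) (\<lambda>t. Q *\<^sub>R z' t - z t)"
          using bounded_primitive_diff[OF bounded_primitive_linear[OF bounded_linear_scaleR_right
              z'[unfolded linear_solution_def], of Q] z[unfolded linear_solution_def]]
          by (simp add: matrix_vector_mult_diff_distrib matrix_vector_mult_scaleR)
        then show ?thesis
          unfolding linear_solution_def w_def
          using bounded_primitive_shift[of "real N" "T - real N"
              "\<lambda>t. gen (\<alpha> t) *v (Q *\<^sub>R z' t - z t)" "\<lambda>t. Q *\<^sub>R z' t - z t"] by simp
      qed
      have w0: "0 \<le> w 0 $ i" for i
      proof -
        have "\<delta> * \<kappa> \<le> \<delta> * z' 0 $ j" using j \<delta>(1) by (simp add: z'_def)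
        also have "\<dots> \<le> z' (real N) $ i" by (rule \<delta>(2)[OF n' N])
        finally have lower: "\<delta> * \<kappa> \<le> z' (real N) $ i" .
        have "\<bar>total_growth G m y (real N)\<bar> \<le> B * real N"
        proof (rule total_growth_bound[OF _ B])
          show "controlled_path G F m (real N) \<alpha> y"
            using p N bounded_primitive_mono[OF _ N] unfolding controlled_path_def by auto
        qed simp_all
        then have "exp (shift_const * real N + total_growth G m y (real N)) \<le> E"
          unfolding E_def by (simp add: algebra_simps)
        moreover have "y (real N) $ i \<le> R + 1"
          using component_le_norm_cart[of "y (real N)" i] R(2)[OF ys[of "real N"]] N by simp
        ultimately have "z (real N) $ i \<le> E * (R + 1)"
          unfolding z_def using E R(1) ys[of "real N"] N by (auto intro!: mult_mono simp: simplex_of_def)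
        also have "\<dots> = Q * (\<delta> * \<kappa>)" using \<delta>(1) \<kappa> by (simp add: Q_def)
        also have "\<dots> \<le> Q * z' (real N) $ i" using Q lower by (intro mult_left_mono) auto
        finally show ?thesis by (simp add: w_def)
      qed
      have c: "control (\<lambda>t. \<alpha> (real N + t))" by (rule control_shift[OF \<alpha>])
      have "0 \<le> w (T - real N) $ i" for i
        by (rule linear_solution_nonneg[OF c w w0]) (use N in auto)
      then have "0 \<le> m \<bullet> w (T - real N)"
        unfolding inner_vec_def using m_nonneg by (auto intro!: sum_nonneg)
      then have "m \<bullet> z T \<le> Q * (m \<bullet> z' T)" by (simp add: w_def inner_diff_right)
      then have "exp (shift_const * T + total_growth G m y T)
          \<le> exp (ln Q) * exp (shift_const * T + total_growth G m y' T)"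
        using ys[of T] ys'[of T] T Q by (simp add: z_def z'_def simplex_of_def)
      then have "total_growth G m y T \<le> total_growth G m y' T + ln Q"
        unfolding exp_add[symmetric] by simp
      moreover have "0 \<le> 2 * B * real N" using B by simp
      ultimately show ?thesis unfolding K_def by linarith
    qed
  qed
qed

section \<open>Periodic controls and global paths\<close>

text \<open>The argument is reduced modulo T. A preimage is a countable union of translates of its
  part in a single period, hence measurable.\<close>

lemma control_periodic:
  assumes "control \<alpha>" "0 < T"
  shows "control (\<lambda>t. \<alpha> (t - T * of_int \<lfloor>t / T\<rfloor>))"
  unfolding control_def
proof (intro conjI allI controlD[OF assms(1)] measurableI)
  fix S :: "real set" assume S: "S \<in> sets borel"
  have "(\<lambda>t. \<alpha> (t - T * of_int \<lfloor>t / T\<rfloor>)) -` S \<inter> space lebesgue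
      = (\<Union>k::int. (+) (T * of_int k) ` (\<alpha> -` S \<inter> {0..<T}))"
  proof (intro equalityI subsetI)
    fix t assume t: "t \<in> (\<lambda>t. \<alpha> (t - T * of_int \<lfloor>t / T\<rfloor>)) -` S \<inter> space lebesgue"
    let ?r = "t - T * of_int \<lfloor>t / T\<rfloor>"
    have "?r \<in> {0..<T}"
      using floor_divide_lower[OF assms(2), of t] floor_divide_upper[OF assms(2), of t]
      by (simp add: algebra_simps)
    moreover have "\<alpha> ?r \<in> S" "t = T * of_int \<lfloor>t / T\<rfloor> + ?r" using t by auto
    ultimately show "t \<in> (\<Union>k::int. (+) (T * of_int k) ` (\<alpha> -` S \<inter> {0..<T}))" by blast
  next
    fix t assume "t \<in> (\<Union>k::int. (+) (T * of_int k) ` (\<alpha> -` S \<inter> {0..<T}))"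
    then obtain k :: int and r where r: "t = T * of_int k + r" "\<alpha> r \<in> S" "0 \<le> r" "r < T" by auto
    have "\<lfloor>t / T\<rfloor> = k"
      by (rule floor_unique) (use r assms(2) in \<open>simp_all add: field_simps\<close>)
    then show "t \<in> (\<lambda>t. \<alpha> (t - T * of_int \<lfloor>t / T\<rfloor>)) -` S \<inter> space lebesgue" using r by simp
  qed
  also have "\<dots> \<in> sets lebesgue"
  proof (rule sets.countable_UN'', rule countableI_type, rule lebesgue_sets_translation)
    have "\<alpha> -` S \<in> sets lebesgue"
      using assms measurable_sets[of \<alpha> lebesgue borel S] S by (simp add: control_def)
    then show "\<alpha> -` S \<inter> {0..<T} \<in> sets lebesgue" by auto
  qed
  finally show "(\<lambda>t. \<alpha> (t - T * of_int \<lfloor>t / T\<rfloor>)) -` S \<inter> space lebesgue \<in> sets lebesgue" .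
qed simp

definition global_path :: "(real \<Rightarrow> real) \<Rightarrow> (real \<Rightarrow> real^'n) \<Rightarrow> bool" where
  "global_path \<alpha> y \<longleftrightarrow> control \<alpha> \<and> (\<forall>T. controlled_path G F m T \<alpha> y)"

lemma global_path_shift:
  assumes "global_path \<alpha> y" "0 \<le> s"
  shows "global_path (\<lambda>t. \<alpha> (s + t)) (\<lambda>t. y (s + t))"
  using assms control_shift controlled_path_shift unfolding global_path_def by blast

lemma global_path_total_growth_shift:
  assumes "global_path \<alpha> y" "0 \<le> s" "0 \<le> t"
  shows "total_growth G m y (s + t) = total_growth G m y s + total_growth G m (\<lambda>r. y (s + r)) t"
  using assms controlled_path_continuous unfolding global_path_def by (intro total_growth_shift) blast+

text \<open>The payoff sees the control only through y, so it is enough that both classes of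
  controls produce the same curves. An admissible control is extended by the value a to nonpositive
  times, which no integral over {0<..t} notices.\<close>

lemma discounted_value_eq:
  "discounted_value G F m a A \<epsilon> y0 =
     Sup {LINT t:{0<..}|lebesgue. exp (- \<epsilon> * t) * growth_rate G m (y t) | \<alpha> y.
            global_path \<alpha> y \<and> y 0 = y0}"
proof -
  have "(\<exists>\<alpha>. admissible_control a A \<alpha> \<and> trajectory G F m \<alpha> y) \<longleftrightarrow> (\<exists>\<alpha>. global_path \<alpha> y)" for y
  proof
    assume "\<exists>\<alpha>. global_path \<alpha> y"
    then obtain \<alpha> where \<alpha>: "control \<alpha>" "\<And>T. controlled_path G F m T \<alpha> y" unfolding global_path_def by blast
    have "admissible_control a A \<alpha>"
      using \<alpha>(1) measurable_restrict_space1 unfolding admissible_control_def control_def by blast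
    moreover have "trajectory G F m \<alpha> y" using \<alpha> trajectory_iff_path by blast
    ultimately show "\<exists>\<alpha>. admissible_control a A \<alpha> \<and> trajectory G F m \<alpha> y" by blast
  next
    assume "\<exists>\<alpha>. admissible_control a A \<alpha> \<and> trajectory G F m \<alpha> y"
    then obtain \<alpha> where \<alpha>: "admissible_control a A \<alpha>" "trajectory G F m \<alpha> y" by blast
    define \<beta> where "\<beta> t = (if t \<in> {0<..} then \<alpha> t else a)" for t
    have "\<beta> \<in> borel_measurable lebesgue"
      unfolding \<beta>_def[abs_def]
    proof (rule measurable_If_restrict_space_iff[THEN iffD2])
      show "{x \<in> space lebesgue. x \<in> {0::real<..}} \<in> sets lebesgue" by simp
    qed (use \<alpha>(1) in \<open>simp_all add: admissible_control_def greaterThan_def\<close>)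
    then have c: "control \<beta>"
      using \<alpha>(1) a_le_A unfolding control_def admissible_control_def \<beta>_def by auto
    have "set_integrable lebesgue {0<..t} (\<lambda>s. drift G F m (y s) (\<alpha> s)) =
        set_integrable lebesgue {0<..t} (\<lambda>s. drift G F m (y s) (\<beta> s))" for t
      by (rule set_integrable_cong) (auto simp: \<beta>_def)
    moreover have "(LINT s:{0<..t}|lebesgue. drift G F m (y s) (\<alpha> s)) =
        (LINT s:{0<..t}|lebesgue. drift G F m (y s) (\<beta> s))" for t
      unfolding set_lebesgue_integral_def
      by (rule Bochner_Integration.integral_cong) (auto simp: \<beta>_def indicator_def)
    ultimately have "trajectory G F m \<alpha> y = trajectory G F m \<beta> y"
      unfolding trajectory_def by (simp only:)
    with \<alpha>(2) have "trajectory G F m \<beta> y" by simp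
    then show "\<exists>\<alpha>. global_path \<alpha> y"
      using c trajectory_iff_path[OF c] unfolding global_path_def by blast
  qed
  then have "(\<exists>\<alpha> y. u = I y \<and> admissible_control a A \<alpha> \<and> trajectory G F m \<alpha> y \<and> y 0 = y0) \<longleftrightarrow>
      (\<exists>\<alpha> y. u = I y \<and> global_path \<alpha> y \<and> y 0 = y0)" for u :: real and I
    by metis
  then show ?thesis unfolding discounted_value_def by (intro arg_cong[of _ _ Sup] Collect_cong)
qed

lemma global_path_exists:
  assumes "control \<alpha>" "y0 \<in> simplex_of m"
  obtains y where "y 0 = y0" "global_path \<alpha> y"
  using controlled_path_exists[OF assms] assms(1) unfolding global_path_def by metis

lemma control_const: "control (\<lambda>_. a)"
  using a_le_A by (simp add: control_def)

lemma simplex_nonempty: "simplex_of m \<noteq> {}"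
proof -
  obtain k :: 'n where True by simp
  have "m \<bullet> axis k (1 / m $ k) = 1"
    using m_pos[of k] by (simp add: inner_axis)
  then have "axis k (1 / m $ k) \<in> simplex_of m"
    using m_nonneg by (auto simp: simplex_of_def axis_def)
  then show ?thesis by blast
qed

lemma total_growth_multiple_le:
  assumes "global_path \<alpha> y" "0 < T"
    and le: "\<And>\<alpha> y. global_path \<alpha> y \<Longrightarrow> total_growth G m y T \<le> S"
  shows "total_growth G m y (real n * T) \<le> real n * S"
  using assms(1)
proof (induction n arbitrary: \<alpha> y)
  case 0 then show ?case by simp
next
  case (Suc n)
  have "total_growth G m y (T + real n * T) =
      total_growth G m y T + total_growth G m (\<lambda>r. y (T + r)) (real n * T)"
    by (rule global_path_total_growth_shift[OF Suc.prems]) (use assms(2) in auto)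
  also have "\<dots> \<le> S + real n * S"
    using assms(2) by (intro add_mono le[OF Suc.prems] Suc.IH[OF global_path_shift[OF Suc.prems]]) simp
  finally show ?case by (simp add: algebra_simps)
qed

lemma total_growth_between_multiples:
  assumes y: "global_path \<alpha> y" and B: "0 \<le> B" "\<And>y. y \<in> simplex_of m \<Longrightarrow> \<bar>growth_rate G m y\<bar> \<le> B"
    and T: "0 < T" and t: "0 \<le> t"
  obtains n :: nat where "t / T - 1 \<le> real n" "real n \<le> t / T"
    "\<bar>total_growth G m y t - total_growth G m y (real n * T)\<bar> \<le> B * T"
proof
  define n where "n = nat \<lfloor>t / T\<rfloor>"
  have n: "real n = of_int \<lfloor>t / T\<rfloor>" using T t by (simp add: n_def)
  show n1: "t / T - 1 \<le> real n" and n2: "real n \<le> t / T" unfolding n by linarith+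
  have r: "0 \<le> t - real n * T" "t - real n * T \<le> T"
    using n1 n2 T by (simp_all add: field_simps)
  have "total_growth G m y (real n * T + (t - real n * T)) =
      total_growth G m y (real n * T) + total_growth G m (\<lambda>s. y (real n * T + s)) (t - real n * T)"
    by (rule global_path_total_growth_shift[OF y]) (use T r in auto)
  moreover have "controlled_path G F m (t - real n * T) (\<lambda>s. \<alpha> (real n * T + s)) (\<lambda>s. y (real n * T + s))"
    using global_path_shift[OF y, of "real n * T"] T by (simp add: global_path_def)
  from total_growth_bound[OF this B r(1)]
  have "\<bar>total_growth G m (\<lambda>s. y (real n * T + s)) (t - real n * T)\<bar> \<le> B * (t - real n * T)" .
  moreover have "B * (t - real n * T) \<le> B * T" by (intro mult_left_mono r B)
  ultimately show "\<bar>total_growth G m y t - total_growth G m y (real n * T)\<bar> \<le> B * T" by simp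
qed

text \<open>Turns a count of complete periods into a linear function of time. The error is bounded
  for either sign of c, as growth per period may be negative.\<close>

lemma mult_floor_approx:
  fixes n T t c :: real
  assumes "t / T - 1 \<le> n" "n \<le> t / T" "0 < T"
  shows "\<bar>n * c - c / T * t\<bar> \<le> \<bar>c\<bar>"
proof -
  have "n * c - c / T * t = (n - t / T) * c" by (simp add: algebra_simps)
  also have "\<bar>\<dots>\<bar> \<le> 1 * \<bar>c\<bar>" unfolding abs_mult using assms by (intro mult_right_mono) auto
  finally show ?thesis by simp
qed

text \<open>The path itself need not be periodic: each period starts wherever the previous one
  ended. Comparison with \<open>y1\<close> under the same control recovers its growth up to K in
  every period, regardless of that starting point.\<close>

lemma periodic_control_growth:
  assumes K: "\<And>T \<alpha> y y'. 0 \<le> T \<Longrightarrow> control \<alpha> \<Longrightarrow> controlled_path G F m T \<alpha> y \<Longrightarrow> controlled_path G F m T \<alpha> y' \<Longrightarrow>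
       total_growth G m y T \<le> total_growth G m y' T + K"
    and y1: "global_path \<alpha>1 y1" and T: "0 < T" and y0: "y0 \<in> simplex_of m"
  obtains \<alpha> y where "global_path \<alpha> y" "y 0 = y0"
    "\<And>n. real n * (total_growth G m y1 T - K) \<le> total_growth G m y (real n * T)"
proof -
  define \<alpha> where "\<alpha> t = \<alpha>1 (t - T * of_int \<lfloor>t / T\<rfloor>)" for t
  have c: "control \<alpha>"
    unfolding \<alpha>_def using y1 T by (intro control_periodic) (auto simp: global_path_def)
  obtain y where y: "y 0 = y0" "global_path \<alpha> y" by (rule global_path_exists[OF c y0])
  have period: "\<alpha> (real n * T + t) = \<alpha>1 t" if "t \<in> {0<..<T}" for n t
  proof -
    have "\<lfloor>(real n * T + t) / T\<rfloor> = int n"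
      by (rule floor_unique) (use that T in \<open>simp_all add: field_simps\<close>)
    then show ?thesis unfolding \<alpha>_def by (simp add: mult.commute)
  qed
  have "real n * (total_growth G m y1 T - K) \<le> total_growth G m y (real n * T)" for n
  proof (induction n)
    case 0 then show ?case by simp
  next
    case (Suc n)
    let ?y = "\<lambda>t. y (real n * T + t)"
    have "controlled_path G F m T (\<lambda>t. \<alpha> (real n * T + t)) ?y"
      using global_path_shift[OF y(2), of "real n * T"] T by (simp add: global_path_def)
    then have "controlled_path G F m T \<alpha>1 ?y" by (rule controlled_path_spike) (rule period)
    then have "total_growth G m y1 T \<le> total_growth G m ?y T + K"
      using K[of T \<alpha>1 y1 ?y] y1 T by (simp add: global_path_def)
    moreover have "total_growth G m y (real n * T + T) =
        total_growth G m y (real n * T) + total_growth G m ?y T"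
      by (rule global_path_total_growth_shift[OF y(2)]) (use T in auto)
    ultimately show ?case using Suc by (simp add: algebra_simps)
  qed
  with y show ?thesis using that by blast
qed

section \<open>Approximating the discounted value by averages over long periods\<close>

text \<open>For each T the approximant is S / T, with S the supremum of the growth over time T from
  arbitrary starting points. The losses per period, 1 for near-optimality and K for comparison, make
  up C; effects of incomplete periods go into D and are damped by \<epsilon>.\<close>

lemma discounted_value_approx:
  obtains C where "0 \<le> C"
    "\<And>T. 0 < T \<Longrightarrow> \<exists>\<sigma> D. \<forall>\<epsilon>>0. \<forall>y\<in>simplex_of m.
       \<bar>\<epsilon> * discounted_value G F m a A \<epsilon> y - \<sigma>\<bar> \<le> C / T + \<epsilon> * D"
proof -
  obtain B where B: "0 \<le> B" "\<And>y. y \<in> simplex_of m \<Longrightarrow> \<bar>growth_rate G m y\<bar> \<le> B"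
    using growth_rate_bound by blast
  obtain K where K: "0 \<le> K"
    "\<And>T \<alpha> y y'. 0 \<le> T \<Longrightarrow> control \<alpha> \<Longrightarrow> controlled_path G F m T \<alpha> y \<Longrightarrow> controlled_path G F m T \<alpha> y' \<Longrightarrow>
       total_growth G m y T \<le> total_growth G m y' T + K"
    by (rule growth_comparison) (rule that)
  define I where "I \<epsilon> y = (LINT t:{0<..}|lebesgue. exp (- \<epsilon> * t) * growth_rate G m (y t))"
    for \<epsilon> and y :: "real \<Rightarrow> real^'n"
  have gc: "continuous_on {0..} (\<lambda>t. growth_rate G m (y t))" if "global_path \<alpha> y" for \<alpha> y
  proof (rule continuous_on_growth_rate)
    have yc: "continuous_on {0..T} y" for T
      using that controlled_path_continuous unfolding global_path_def by blast
    show "continuous_on {0..} y"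
      unfolding continuous_on_eq_continuous_within
    proof
      fix t :: real assume t: "t \<in> {0..}"
      have "continuous (at t within {0..t + 1}) y"
        using yc[of "t + 1"] t by (auto simp: continuous_on_eq_continuous_within)
      moreover have "at t within {0..t + 1} = at t within {0..}"
        by (rule at_within_nhd[of _ "{..<t + 1}"]) auto
      ultimately show "continuous (at t within {0..}) y" by simp
    qed
  qed
  have gb: "\<bar>growth_rate G m (y t)\<bar> \<le> B" if "global_path \<alpha> y" "0 \<le> t" for \<alpha> y t
  proof (rule B(2))
    have "controlled_path G F m t \<alpha> y" using that unfolding global_path_def by blast
    then show "y t \<in> simplex_of m" using that unfolding controlled_path_def by auto
  qed
  show ?thesis
  proof (rule that[of "1 + K"])
    show "0 \<le> 1 + K" using K by simp
    fix T :: real assume T: "0 < T"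
    define X where "X = {total_growth G m y T | \<alpha> y. global_path \<alpha> y}"
    define S where "S = Sup X"
    have Xb: "x \<le> B * T" if "x \<in> X" for x
    proof -
      obtain \<alpha> y where x: "x = total_growth G m y T" and y: "controlled_path G F m T \<alpha> y"
        using \<open>x \<in> X\<close> unfolding X_def global_path_def by blast
      from total_growth_bound[OF y B less_imp_le[OF T]] show ?thesis unfolding x by linarith
    qed
    have bdd: "bdd_above X" by (rule bdd_aboveI[OF Xb])
    obtain y0 where y0: "y0 \<in> simplex_of m" using simplex_nonempty by blast
    obtain z where "global_path (\<lambda>_. a) z" by (rule global_path_exists[OF control_const y0])
    then have Xne: "X \<noteq> {}" unfolding X_def by blast
    have le_S: "total_growth G m y T \<le> S" if "global_path \<alpha> y" for \<alpha> y
      unfolding S_def by (rule cSup_upper[OF _ bdd]) (use that in \<open>auto simp: X_def\<close>)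
    \<comment> \<open>The supremum need not be attained; the unit tolerance used here is the 1 in
      \<open>1 + K\<close>.\<close>
    obtain x where x: "x \<in> X" "S - 1 < x"
      using less_cSupD[OF Xne, of "S - 1"] unfolding S_def by auto
    then obtain \<alpha>1 y1 where y1: "global_path \<alpha>1 y1" "S - 1 < total_growth G m y1 T"
      unfolding X_def by blast
    \<comment> \<open>A guaranteed growth per period for the repeated control, from every starting
      point.\<close>
    define c where "c = S - 1 - K"
    \<comment> \<open>\<open>B * T\<close> covers an incomplete period; the other summands cover the
      rounding of t / T for the upper slope S / T and the lower slope c / T.\<close>
    define D where "D = B * T + \<bar>S\<bar> + \<bar>c\<bar>"
    have upper: "I \<epsilon> y \<le> (S / T) / \<epsilon> + D" if \<epsilon>: "0 < \<epsilon>" and y: "global_path \<alpha> y" for \<epsilon> \<alpha> y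
      unfolding I_def
    proof (rule laplace_transform_le[OF gc[OF y] gb[OF y] \<epsilon>])
      fix t :: real assume t: "0 \<le> t"
      obtain n :: nat where n: "t / T - 1 \<le> real n" "real n \<le> t / T"
        "\<bar>total_growth G m y t - total_growth G m y (real n * T)\<bar> \<le> B * T"
        by (rule total_growth_between_multiples[OF y B T t])
      have "total_growth G m y (real n * T) \<le> real n * S"
        by (rule total_growth_multiple_le[OF y T le_S])
      then have "total_growth G m y t \<le> S / T * t + D"
        using n(3) mult_floor_approx[OF n(1,2) T, of S] unfolding D_def by linarith
      then show "integral {0..t} (\<lambda>t. growth_rate G m (y t)) \<le> S / T * t + D"
        unfolding total_growth_def .
    qed
    have "\<bar>\<epsilon> * discounted_value G F m a A \<epsilon> y0 - S / T\<bar> \<le> (1 + K) / T + \<epsilon> * D"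
      if \<epsilon>: "0 < \<epsilon>" and y0: "y0 \<in> simplex_of m" for \<epsilon> y0
    proof -
      let ?V = "{I \<epsilon> y | \<alpha> y. global_path \<alpha> y \<and> y 0 = y0}"
      have dv: "discounted_value G F m a A \<epsilon> y0 = Sup ?V"
        unfolding discounted_value_eq I_def ..
      have "\<exists>\<alpha> y. global_path \<alpha> y \<and> y 0 = y0 \<and>
          (\<forall>n. real n * (total_growth G m y1 T - K) \<le> total_growth G m y (real n * T))"
      proof (rule periodic_control_growth[OF _ y1(1) T y0])
        show "total_growth G m y t \<le> total_growth G m y' t + K"
          if "0 \<le> t" "control \<alpha>" "controlled_path G F m t \<alpha> y" "controlled_path G F m t \<alpha> y'" for t \<alpha> y y'
          by (rule K(2)[OF that])
      qed (intro exI conjI allI)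
      then obtain \<alpha> y where y: "global_path \<alpha> y" "y 0 = y0"
        "\<And>n. real n * (total_growth G m y1 T - K) \<le> total_growth G m y (real n * T)"
        by blast
      have lower: "(c / T) / \<epsilon> - D \<le> I \<epsilon> y"
        unfolding I_def
      proof (rule laplace_transform_ge[OF gc[OF y(1)] gb[OF y(1)] \<epsilon>])
        fix t :: real assume t: "0 \<le> t"
        obtain n :: nat where n: "t / T - 1 \<le> real n" "real n \<le> t / T"
          "\<bar>total_growth G m y t - total_growth G m y (real n * T)\<bar> \<le> B * T"
          by (rule total_growth_between_multiples[OF y(1) B T t])
        have "real n * c \<le> real n * (total_growth G m y1 T - K)"
          using y1(2) by (intro mult_left_mono) (auto simp: c_def)
        then have "c / T * t - D \<le> total_growth G m y t"
          using n(3) y(3)[of n] mult_floor_approx[OF n(1,2) T, of c] unfolding D_def by linarith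
        then show "c / T * t - D \<le> integral {0..t} (\<lambda>t. growth_rate G m (y t))"
          unfolding total_growth_def .
      qed
      have mem: "I \<epsilon> y \<in> ?V" using y by blast
      have ub: "v \<le> (S / T) / \<epsilon> + D" if "v \<in> ?V" for v using that upper[OF \<epsilon>] by blast
      have "Sup ?V \<le> (S / T) / \<epsilon> + D" by (rule cSup_least) (use mem ub in blast)+
      moreover have "I \<epsilon> y \<le> Sup ?V"
        by (rule cSup_upper[OF mem bdd_aboveI]) (rule ub)
      ultimately have 1: "(c / T) / \<epsilon> - D \<le> Sup ?V" "Sup ?V \<le> (S / T) / \<epsilon> + D"
        using lower by linarith+
      have "\<epsilon> * Sup ?V \<le> S / T + \<epsilon> * D"
        using mult_left_mono[OF 1(2), of \<epsilon>] \<epsilon> by (simp add: distrib_left)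
      moreover have "c / T - \<epsilon> * D \<le> \<epsilon> * Sup ?V"
        using mult_left_mono[OF 1(1), of \<epsilon>] \<epsilon> by (simp add: right_diff_distrib)
      moreover have "c / T = S / T - (1 + K) / T" by (simp add: c_def diff_divide_distrib add_divide_distrib)
      moreover have "0 \<le> (1 + K) / T" using K T by simp
      ultimately show ?thesis unfolding dv by linarith
    qed
    then show "\<exists>\<sigma> D. \<forall>\<epsilon>>0. \<forall>y\<in>simplex_of m.
        \<bar>\<epsilon> * discounted_value G F m a A \<epsilon> y - \<sigma>\<bar> \<le> (1 + K) / T + \<epsilon> * D"
      by blast
  qed
qed

lemma discounted_value_uniform_limit:
  "\<exists>l. uniform_limit (simplex_of m)
    (\<lambda>\<epsilon> y. \<epsilon> * discounted_value G F m a A \<epsilon> y) (\<lambda>_. l) (at_right 0)"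
proof -
  obtain C where C: "0 \<le> C" "\<And>T. 0 < T \<Longrightarrow> \<exists>\<sigma> D. \<forall>\<epsilon>>0. \<forall>y\<in>simplex_of m.
       \<bar>\<epsilon> * discounted_value G F m a A \<epsilon> y - \<sigma>\<bar> \<le> C / T + \<epsilon> * D"
    by (rule discounted_value_approx) (rule that)
  show ?thesis by (rule uniform_limit_const_of_approx[OF C(2) C(1)])
qed

end

theorem theorem3p2:
  fixes G F :: "real^3^3" and m :: "real^3" and a A :: real
    and e :: "real \<Rightarrow> real^3" and e_inf :: "real^3"
  assumes "metzler G" and "metzler F"
    and "\<forall>i. 0 < m $ i" and "m v* F = 0"
    and "0 < a" and "a < A"
    and e_pos: "\<forall>\<alpha>>0. e \<alpha> = perron_vector m (G + \<alpha> *\<^sub>R F)"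
    and e_zero: "(e \<longlongrightarrow> e 0) (at_right 0)"
    and e_inf: "(e \<longlongrightarrow> e_inf) at_top"
    and h1: "reducible G" "reducible F" "\<forall>\<alpha>>0. \<not> reducible (G + \<alpha> *\<^sub>R F)"
    and h2: "bounded ((\<lambda>\<alpha>. perron_value (G + \<alpha> *\<^sub>R F)) ` {0<..})"
      "\<exists>\<alpha>s. a < \<alpha>s \<and> \<alpha>s < A \<and>
         (\<forall>\<alpha>>0. perron_value (G + \<alpha> *\<^sub>R F) \<le> perron_value (G + \<alpha>s *\<^sub>R F))"
    and h3: "\<exists>i. e 0 $ i = 0" "\<exists>i. e_inf $ i = 0"
    and h4: "e differentiable (at 0 within {0..})"
      "(\<forall>\<alpha>\<ge>0. 0 < vector_derivative e (at \<alpha> within {0..}) \<bullet> quarter_turn m (F *v e \<alpha>)) \<or>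
       (\<forall>\<alpha>\<ge>0. vector_derivative e (at \<alpha> within {0..}) \<bullet> quarter_turn m (F *v e \<alpha>) < 0)"
    and h5: "\<exists>\<delta>>0.
      (\<forall>\<beta>\<in>{A - \<delta><..<A + \<delta>}. \<forall>y. trajectory G F m (\<lambda>_. \<beta>) y \<and> y 0 = e 0 \<longrightarrow>
         (\<forall>t>0. y t \<notin> e ` {0..})) \<and>
      (\<forall>\<beta>\<in>{a - \<delta><..<a + \<delta>}. \<forall>y. trajectory G F m (\<lambda>_. \<beta>) y \<and> y 0 = e_inf \<longrightarrow>
         (\<forall>t>0. y t \<notin> e ` {0..}))"
  shows "\<exists>l_HJ. uniform_limit (simplex_of m)
    (\<lambda>\<epsilon> y. \<epsilon> * discounted_value G F m a A \<epsilon> y) (\<lambda>_. l_HJ) (at_right 0)"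
proof -
  \<comment> \<open>The locale's irreducible matrix is the instance of \<open>h1(3)\<close> at the
    lower control bound a.\<close>
  interpret controlled_metzler G F m a A
    by (rule controlled_metzler.intro) (use assms(1-6) h1(3) in auto)
  show ?thesis by (rule discounted_value_uniform_limit)
qed

end
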